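(* Let $K$ be a positive, nontrivial, commutative semiring that is both additively and multiplicatively cancellative. Then the axiomatization $\mathcal A:=\mathcal A_{IA}\cup\{\text{IA\&FD 1}\}\cup\mathcal A_{UCA\&UMDE}\cup\mathcal A_{UMI}\cup\mathcal A_{UMDE}\cup\mathcal A_{UMI\&UMDE}$ is sound and complete for the implication problem for IAs+UCAs+UMIs+UMDEs over $K$: for every finite set of variables $D$ and every finite set $\Sigma\cup\{\tau\}$ of atoms over $D$, each of which is a (disjoint) independence atom, a unary constancy atom, a unary marginal identity atom or a unary marginal distribution equivalence atom, $\Sigma\vdash_{\mathcal A}\tau$ iff $\Sigma\models_K\tau$.
   Context: Semirings $(K,+,\times,0,1)$: $(K,+,0)$ commutative monoid, $(K,\times,1)$ monoid, two-sided distributivity, $0\times a=a\times0=0$. Positive: $a+b=0\Rightarrow a=b=0$, $a\times b=0\Rightarrow a=0$ or $b=0$. Commutative: $\times$ commutative. Additively cancellative: $a+b=a+c\Rightarrow b=c$. Multiplicatively cancellative: for $a\neq0$, $a\times b=a\times c\Rightarrow b=c$ and $b\times a=c\times a\Rightarrow b=c$. $K$-teams: $D$ finite set of variables, $A$ finite set of values, $X$ finite set of assignments $s:D\to A$, $\mathbb X:X\to K$. $\mathrm{Supp}(\mathbb X)=\{s:\mathbb X(s)\ne0\}$; $|\mathbb X_{\bar x=\bar a}|=\sum_{s\in X,\,s(\bar x)=\bar a}\mathbb X(s)$ (empty sum $0$); $|\mathbb X|=\sum_{s\in X}\mathbb X(s)$; $X(x)=\{a:|\mathbb X_{x=a}|\ne0\}$.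 $\mathrm{Var}(\bar x)$: set of variables of $\bar x$; tuples are disjoint if their variable sets are disjoint. Atoms: constancy atom $=\!(\bar y)$: all $s,s'\in\mathrm{Supp}(\mathbb X)$ have $s(\bar y)=s'(\bar y)$ (unary if $\bar y$ is a single variable). Independence atom $\bar y\perp\bar z$ for disjoint tuples (possibly empty): $|\mathbb X_{\bar y\bar z=s(\bar y\bar z)}|\times|\mathbb X|=|\mathbb X_{\bar y=s(\bar y)}|\times|\mathbb X_{\bar z=s(\bar z)}|$ for all $s:\mathrm{Var}(\bar y\bar z)\to A$. Unary marginal identity $x\approx y$: $|\mathbb X_{x=a}|=|\mathbb X_{y=a}|$ for all $a\in A$. Unary marginal distribution equivalence $x\approx^*y$: multisets $\{\{|\mathbb X_{x=a}|:a\in X(x)\}\}$, $\{\{|\mathbb X_{y=a}|:a\in X(y)\}\}$ are equal. $\Sigma\models_K\tau$: every $K$-team over $D$ satisfying all of $\Sigma$ satisfies $\tau$. Deduction: $\Sigma\vdash_{\mathcal A}\sigma$ iff there is a sequence $\tau_1,\dots,\tau_n=\sigma$ with each $\tau_i\in\Sigma$ or $\tau_i\in\Gamma$ for an instance $\Lambda\vdash\Gamma$ of an axiom of $\mathcal A$ with $\Lambda\subseteq\Sigma\cup\{\tau_1,\dots,\tau_{i-1}\}$. Axioms. $\mathcal A_{IA}$: $\emptyset\vdash\emptyset\perp\bar x$; $\bar x\perp\bar y\vdash\bar y\perp\bar x$; $\bar x\perp\bar y\vdash\bar x'\perp\bar y'$ whenever $\mathrm{Var}(\bar x')\subseteq\mathrm{Var}(\bar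 x)$, $\mathrm{Var}(\bar y')\subseteq\mathrm{Var}(\bar y)$; $\{\bar x\perp\bar y,\bar x\bar y\perp\bar z\}\vdash\bar x\perp\bar y\bar z$. IA\&FD 1: $\{\bar x\perp\bar y,=\!(\bar z)\}\vdash\bar x\perp\bar y\bar z$. $\mathcal A_{UCA\&UMDE}$ (single variables): $\{x\approx^*y,=\!(y)\}\vdash=\!(x)$; $\{=\!(x),=\!(y)\}\vdash x\approx^*y$. $\mathcal A_{UMI}$: $\emptyset\vdash x\approx x$; $x\approx y\vdash y\approx x$; $\{x\approx y,y\approx z\}\vdash x\approx z$. $\mathcal A_{UMDE}$: $\emptyset\vdash x\approx^*x$; $x\approx^*y\vdash y\approx^*x$; $\{x\approx^*y,y\approx^*z\}\vdash x\approx^*z$. $\mathcal A_{UMI\&UMDE}$: $x\approx y\vdash x\approx^*y$. All independence atoms have pairwise disjoint tuples. *)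

theory Defs
  imports Main "HOL-Library.FuncSet" "HOL-Library.Multiset"
begin

text \<open>Tuples of variables are lists; the set of variables of a tuple is \<open>set\<close>.\<close>

datatype 'v atom =
    Constancy "'v list"
  | Indep "'v list" "'v list"  (infix "\<bottom>\<bottom>" 55)
  | UMI 'v 'v  (infix "\<approx>" 55)
  | UMDE 'v 'v  (infix "\<approx>*" 55)

fun atom_over :: "'v set \<Rightarrow> 'v atom \<Rightarrow> bool" where
  "atom_over D (Constancy ys) \<longleftrightarrow> set ys \<subseteq> D"
| "atom_over D (ys \<bottom>\<bottom> zs) \<longleftrightarrow> set ys \<subseteq> D \<and> set zs \<subseteq> D \<and> set ys \<inter> set zs = {}"
| "atom_over D (x \<approx> y) \<longleftrightarrow> x \<in> D \<and> y \<in> D"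
| "atom_over D (x \<approx>* y) \<longleftrightarrow> x \<in> D \<and> y \<in> D"

fun unary_constancy :: "'v atom \<Rightarrow> bool" where
  "unary_constancy (Constancy ys) \<longleftrightarrow> length ys = 1"
| "unary_constancy _ \<longleftrightarrow> True"

definition IA_UCA_UMI_UMDE_atoms :: "'v set \<Rightarrow> 'v atom set" where
  "IA_UCA_UMI_UMDE_atoms D = {\<phi>. atom_over D \<phi> \<and> unary_constancy \<phi>}"


section \<open>Teams\<close>

text \<open>
  A team over \<open>D\<close> is given by a value set \<open>A\<close>, a set \<open>X\<close> of assignments and a weight function
  \<open>w\<close>, of which only the values on \<open>X\<close> matter. Assignments \<open>D \<rightarrow> A\<close> are extensional functions,
  so that distinct elements of \<open>X\<close> differ on \<open>D\<close>.
\<close>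

definition team :: "'v set \<Rightarrow> 'a set \<Rightarrow> ('v \<Rightarrow> 'a) set \<Rightarrow> bool" where
  "team D A X \<longleftrightarrow> finite A \<and> finite X \<and> X \<subseteq> D \<rightarrow>\<^sub>E A"

definition supp :: "('v \<Rightarrow> 'a) set \<Rightarrow> (('v \<Rightarrow> 'a) \<Rightarrow> 'k::zero) \<Rightarrow> ('v \<Rightarrow> 'a) set" where
  "supp X w = {s \<in> X. w s \<noteq> 0}"

definition total :: "('v \<Rightarrow> 'a) set \<Rightarrow> (('v \<Rightarrow> 'a) \<Rightarrow> 'k::comm_monoid_add) \<Rightarrow> 'k" where
  "total X w = (\<Sum>s\<in>X. w s)"

definition marginal ::
  "('v \<Rightarrow> 'a) set \<Rightarrow> (('v \<Rightarrow> 'a) \<Rightarrow> 'k::comm_monoid_add) \<Rightarrow> 'v list \<Rightarrow> 'a list \<Rightarrow> 'k" where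
  "marginal X w xs as = (\<Sum>s | s \<in> X \<and> map s xs = as. w s)"

definition values_of ::
  "'a set \<Rightarrow> ('v \<Rightarrow> 'a) set \<Rightarrow> (('v \<Rightarrow> 'a) \<Rightarrow> 'k::comm_monoid_add) \<Rightarrow> 'v \<Rightarrow> 'a set" where
  "values_of A X w x = {a \<in> A. marginal X w [x] [a] \<noteq> 0}"

definition marginal_mset ::
  "'a set \<Rightarrow> ('v \<Rightarrow> 'a) set \<Rightarrow> (('v \<Rightarrow> 'a) \<Rightarrow> 'k::comm_monoid_add) \<Rightarrow> 'v \<Rightarrow> 'k multiset" where
  "marginal_mset A X w x =
     image_mset (\<lambda>a. marginal X w [x] [a]) (mset_set (values_of A X w x))"

fun sat ::
  "'a set \<Rightarrow> ('v \<Rightarrow> 'a) set \<Rightarrow> (('v \<Rightarrow> 'a) \<Rightarrow> 'k::semiring_1) \<Rightarrow> 'v atom \<Rightarrow> bool" where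
  "sat A X w (Constancy ys) \<longleftrightarrow>
     (\<forall>s\<in>supp X w. \<forall>s'\<in>supp X w. map s ys = map s' ys)"
| "sat A X w (ys \<bottom>\<bottom> zs) \<longleftrightarrow>
     (\<forall>s \<in> set (ys @ zs) \<rightarrow>\<^sub>E A.
        marginal X w (ys @ zs) (map s (ys @ zs)) * total X w =
        marginal X w ys (map s ys) * marginal X w zs (map s zs))"
| "sat A X w (x \<approx> y) \<longleftrightarrow> (\<forall>a\<in>A. marginal X w [x] [a] = marginal X w [y] [a])"
| "sat A X w (x \<approx>* y) \<longleftrightarrow> marginal_mset A X w x = marginal_mset A X w y"

text \<open>
  The two type arguments are the semiring \<open>K\<close> and a universe of values from which the finite
  value sets are drawn. Every infinite universe contains a copy of every finite set.
\<close>

definition entails ::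
  "'k::semiring_1 itself \<Rightarrow> 'a itself \<Rightarrow> 'v set \<Rightarrow> 'v atom set \<Rightarrow> 'v atom \<Rightarrow> bool" where
  "entails _ _ D \<Sigma> \<tau> \<longleftrightarrow>
     (\<forall>(A :: 'a set) X (w :: ('v \<Rightarrow> 'a) \<Rightarrow> 'k).
        team D A X \<longrightarrow> (\<forall>\<sigma>\<in>\<Sigma>. sat A X w \<sigma>) \<longrightarrow> sat A X w \<tau>)"


section \<open>Axioms and deduction\<close>

text \<open>An axiom is the set of its instances, pairs of a premise set and a conclusion set.\<close>

type_synonym 'v axioms = "('v atom set \<times> 'v atom set) set"

definition ax_IA :: "'v axioms" where
  "ax_IA =
     {({}, {[] \<bottom>\<bottom> xs}) | xs. True} \<union>
     {({xs \<bottom>\<bottom> ys}, {ys \<bottom>\<bottom> xs}) | xs ys. True} \<union>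
     {({xs \<bottom>\<bottom> ys}, {xs' \<bottom>\<bottom> ys'}) | xs ys xs' ys'. set xs' \<subseteq> set xs \<and> set ys' \<subseteq> set ys} \<union>
     {({xs \<bottom>\<bottom> ys, (xs @ ys) \<bottom>\<bottom> zs}, {xs \<bottom>\<bottom> (ys @ zs)}) | xs ys zs. True}"

definition ax_IA_FD_1 :: "'v axioms" where
  "ax_IA_FD_1 = {({xs \<bottom>\<bottom> ys, Constancy zs}, {xs \<bottom>\<bottom> (ys @ zs)}) | xs ys zs. True}"

definition ax_UCA_UMDE :: "'v axioms" where
  "ax_UCA_UMDE =
     {({x \<approx>* y, Constancy [y]}, {Constancy [x]}) | x y. True} \<union>
     {({Constancy [x], Constancy [y]}, {x \<approx>* y}) | x y. True}"

definition ax_UMI :: "'v axioms" where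
  "ax_UMI =
     {({}, {x \<approx> x}) | x. True} \<union>
     {({x \<approx> y}, {y \<approx> x}) | x y. True} \<union>
     {({x \<approx> y, y \<approx> z}, {x \<approx> z}) | x y z. True}"

definition ax_UMDE :: "'v axioms" where
  "ax_UMDE =
     {({}, {x \<approx>* x}) | x. True} \<union>
     {({x \<approx>* y}, {y \<approx>* x}) | x y. True} \<union>
     {({x \<approx>* y, y \<approx>* z}, {x \<approx>* z}) | x y z. True}"

definition ax_UMI_UMDE :: "'v axioms" where
  "ax_UMI_UMDE = {({x \<approx> y}, {x \<approx>* y}) | x y. True}"

text \<open>
  The instances over \<open>D\<close> are those built from atoms over \<open>D\<close>; in particular all independence
  atoms in them have disjoint tuples.
\<close>

definition axiom_instances :: "'v set \<Rightarrow> 'v axioms" where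
  "axiom_instances D =
     {(\<Lambda>, \<Gamma>) \<in> ax_IA \<union> ax_IA_FD_1 \<union> ax_UCA_UMDE \<union> ax_UMI \<union> ax_UMDE \<union> ax_UMI_UMDE.
        \<forall>\<phi> \<in> \<Lambda> \<union> \<Gamma>. atom_over D \<phi>}"

definition derives :: "'v axioms \<Rightarrow> 'v atom set \<Rightarrow> 'v atom \<Rightarrow> bool" where
  "derives R \<Sigma> \<sigma> \<longleftrightarrow>
     (\<exists>\<tau>s. \<tau>s \<noteq> [] \<and> last \<tau>s = \<sigma> \<and>
        (\<forall>i < length \<tau>s. \<tau>s ! i \<in> \<Sigma> \<or>
           (\<exists>(\<Lambda>, \<Gamma>) \<in> R. \<Lambda> \<subseteq> \<Sigma> \<union> set (take i \<tau>s) \<and> \<tau>s ! i \<in> \<Gamma>)))"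

end

theory Submission
  imports Defs
begin

text \<open>
  A positive, additively cancellative semiring contains the natural numbers, so for completeness
  it suffices to refute an underivable atom by a set of equally weighted assignments in which
  every variable is uniformly distributed on a set of values. For the unary atoms all variables
  are independent, derivably constant variables take one value, and the value sets of the others
  are chosen along the derivability classes of \<open>\<approx>\<close> or \<open>\<approx>*\<close>. For an independence atom, shrink it
  to a minimal underivable atom between sets \<open>V\<close> and \<open>W\<close>; it involves no derivable constants.
  Take uniform bits for the nonconstant variables, subject only to even parity on \<open>V \<union> W\<close>
  (the construction of Geiger, Paz and Pearl). Every proper subset of \<open>V \<union> W\<close> remains independent, so
  this team violates just the atoms that split \<open>V \<union> W\<close> into two nonempty parts, and by minimality
  none of those is derivable. All nonconstant variables have the same marginal, hence the
  marginal atoms do not interfere.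
\<close>

section \<open>Derivations\<close>

text \<open>The condition in \<open>derives\<close> freed from its demand on the last entry, so that
  derivations, the empty one included, can be extended and concatenated.\<close>

definition derivation :: "'v axioms \<Rightarrow> 'v atom set \<Rightarrow> 'v atom list \<Rightarrow> bool" where
  "derivation R \<Sigma> \<tau>s \<longleftrightarrow>
     (\<forall>i < length \<tau>s. \<tau>s ! i \<in> \<Sigma> \<or>
        (\<exists>(\<Lambda>, \<Gamma>) \<in> R. \<Lambda> \<subseteq> \<Sigma> \<union> set (take i \<tau>s) \<and> \<tau>s ! i \<in> \<Gamma>))"

lemma derives_iff_derivation:
  "derives R \<Sigma> \<sigma> \<longleftrightarrow> (\<exists>\<tau>s. \<tau>s \<noteq> [] \<and> last \<tau>s = \<sigma> \<and> derivation R \<Sigma> \<tau>s)"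
  by (simp add: derives_def derivation_def)

lemma derivation_Nil: "derivation R \<Sigma> []"
  by (simp add: derivation_def)

lemma derivation_snoc:
  "derivation R \<Sigma> (\<tau>s @ [\<tau>]) \<longleftrightarrow> derivation R \<Sigma> \<tau>s \<and>
     (\<tau> \<in> \<Sigma> \<or> (\<exists>(\<Lambda>, \<Gamma>) \<in> R. \<Lambda> \<subseteq> \<Sigma> \<union> set \<tau>s \<and> \<tau> \<in> \<Gamma>))"
  unfolding derivation_def by (auto simp: less_Suc_eq nth_append)

text \<open>A prefix only enlarges the stock of earlier formulas from which each step of
  \<open>\<tau>s\<close> may draw its premises.\<close>

lemma derivation_append:
  assumes "derivation R \<Sigma> \<rho>s" "derivation R \<Sigma> \<tau>s"
  shows "derivation R \<Sigma> (\<rho>s @ \<tau>s)"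
  using assms(2)
proof (induction \<tau>s rule: rev_induct)
  case Nil
  then show ?case using assms(1) by simp
next
  case (snoc \<tau> \<tau>s)
  then have d: "derivation R \<Sigma> (\<rho>s @ \<tau>s)"
    and "\<tau> \<in> \<Sigma> \<or> (\<exists>(\<Lambda>, \<Gamma>) \<in> R. \<Lambda> \<subseteq> \<Sigma> \<union> set \<tau>s \<and> \<tau> \<in> \<Gamma>)"
    by (auto simp: derivation_snoc)
  then have "\<tau> \<in> \<Sigma> \<or> (\<exists>(\<Lambda>, \<Gamma>) \<in> R. \<Lambda> \<subseteq> \<Sigma> \<union> set (\<rho>s @ \<tau>s) \<and> \<tau> \<in> \<Gamma>)"
    by fastforce
  with d show ?case
    using derivation_snoc[of R \<Sigma> "\<rho>s @ \<tau>s" \<tau>] by simp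
qed

lemma derives_hyp: "\<sigma> \<in> \<Sigma> \<Longrightarrow> derives R \<Sigma> \<sigma>"
  unfolding derives_iff_derivation
  by (rule exI[of _ "[\<sigma>]"]) (simp add: derivation_def)

text \<open>Concatenating derivations of the finitely many premises gives one list that contains
  them all; the conclusion is then appended.\<close>

lemma derives_step:
  assumes "(\<Lambda>, \<Gamma>) \<in> R" "finite \<Lambda>" "\<And>\<phi>. \<phi> \<in> \<Lambda> \<Longrightarrow> derives R \<Sigma> \<phi>" "\<sigma> \<in> \<Gamma>"
  shows "derives R \<Sigma> \<sigma>"
proof -
  have "\<exists>\<tau>s. derivation R \<Sigma> \<tau>s \<and> \<Lambda> \<subseteq> set \<tau>s"
    using assms(2,3)
  proof (induction \<Lambda> rule: finite_induct)
    case empty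
    then show ?case using derivation_Nil by blast
  next
    case (insert \<phi> \<Lambda>)
    then obtain \<tau>s where "derivation R \<Sigma> \<tau>s" "\<Lambda> \<subseteq> set \<tau>s" by blast
    moreover obtain \<rho>s where "\<rho>s \<noteq> []" "last \<rho>s = \<phi>" "derivation R \<Sigma> \<rho>s"
      using insert.prems[of \<phi>] by (auto simp: derives_iff_derivation)
    ultimately have "derivation R \<Sigma> (\<rho>s @ \<tau>s) \<and> insert \<phi> \<Lambda> \<subseteq> set (\<rho>s @ \<tau>s)"
      using derivation_append by auto
    then show ?case by blast
  qed
  then obtain \<tau>s where "derivation R \<Sigma> \<tau>s" "\<Lambda> \<subseteq> set \<tau>s" by blast
  then have "derivation R \<Sigma> (\<tau>s @ [\<sigma>])"
    unfolding derivation_snoc using assms(1,4) by blast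
  then show ?thesis
    unfolding derives_iff_derivation by (intro exI[of _ "\<tau>s @ [\<sigma>]"]) simp
qed

text \<open>The induction principle for derivability. \<open>P\<close> will be satisfaction in a
  fixed team, and later being an atom over \<open>D\<close>.\<close>

lemma derives_sound:
  assumes "derives R \<Sigma> \<sigma>"
    and "\<And>\<phi>. \<phi> \<in> \<Sigma> \<Longrightarrow> P \<phi>"
    and "\<And>\<Lambda> \<Gamma> \<phi>. (\<Lambda>, \<Gamma>) \<in> R \<Longrightarrow> (\<And>\<psi>. \<psi> \<in> \<Lambda> \<Longrightarrow> P \<psi>) \<Longrightarrow> \<phi> \<in> \<Gamma> \<Longrightarrow> P \<phi>"
  shows "P \<sigma>"
proof -
  have "\<forall>\<phi>\<in>set \<tau>s. P \<phi>" if "derivation R \<Sigma> \<tau>s" for \<tau>s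
    using that
  proof (induction \<tau>s rule: rev_induct)
    case Nil
    then show ?case by simp
  next
    case (snoc \<tau> \<tau>s)
    then have IH: "\<forall>\<phi>\<in>set \<tau>s. P \<phi>" by (simp add: derivation_snoc)
    have "\<tau> \<in> \<Sigma> \<or> (\<exists>(\<Lambda>, \<Gamma>) \<in> R. \<Lambda> \<subseteq> \<Sigma> \<union> set \<tau>s \<and> \<tau> \<in> \<Gamma>)"
      using snoc.prems by (simp add: derivation_snoc)
    then have "P \<tau>"
    proof
      assume "\<exists>(\<Lambda>, \<Gamma>) \<in> R. \<Lambda> \<subseteq> \<Sigma> \<union> set \<tau>s \<and> \<tau> \<in> \<Gamma>"
      then obtain \<Lambda> \<Gamma> where r: "(\<Lambda>, \<Gamma>) \<in> R" "\<Lambda> \<subseteq> \<Sigma> \<union> set \<tau>s" "\<tau> \<in> \<Gamma>" by blast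
      show "P \<tau>"
        by (rule assms(3)[OF r(1) _ r(3)]) (use r(2) IH assms(2) in blast)
    qed (rule assms(2))
    with IH show ?case by simp
  qed
  then show ?thesis
    using assms(1) last_in_set unfolding derives_iff_derivation by metis
qed

section \<open>Soundness\<close>

definition mass ::
  "('v \<Rightarrow> 'a) set \<Rightarrow> (('v \<Rightarrow> 'a) \<Rightarrow> 'k::comm_monoid_add) \<Rightarrow> 'v set \<Rightarrow> ('v \<Rightarrow> 'a) \<Rightarrow> 'k" where
  "mass X w V s = (\<Sum>t | t \<in> X \<and> (\<forall>v\<in>V. t v = s v). w t)"

text \<open>Semantic independence on sets of variables: order and repetitions in tuples disappear
  and concatenation becomes union. Here \<open>s\<close> ranges over all functions, not only over
  those with values in the value set.\<close>

definition indep ::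
  "('v \<Rightarrow> 'a) set \<Rightarrow> (('v \<Rightarrow> 'a) \<Rightarrow> 'k::semiring_1) \<Rightarrow> 'v set \<Rightarrow> 'v set \<Rightarrow> bool" where
  "indep X w V W \<longleftrightarrow> (\<forall>s. mass X w (V \<union> W) s * total X w = mass X w V s * mass X w W s)"

lemma marginal_eq_mass: "marginal X w xs (map s xs) = mass X w (set xs) s"
  by (simp add: marginal_def mass_def)

lemma marginal_singleton: "marginal X w [x] [a] = (\<Sum>s | s \<in> X \<and> s x = a. w s)"
  by (simp add: marginal_def)

lemma mass_empty: "mass X w {} s = total X w"
  by (simp add: mass_def total_def)

lemma mass_cong: "(\<And>v. v \<in> V \<Longrightarrow> s v = s' v) \<Longrightarrow> mass X w V s = mass X w V s'"
  unfolding mass_def by (intro arg_cong[of _ _ "sum w"]) auto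

text \<open>This settles the functions \<open>s\<close> over which \<open>indep\<close> quantifies
  but \<open>sat\<close> does not.\<close>

lemma mass_eq_0_outside:
  assumes "X \<subseteq> D \<rightarrow>\<^sub>E A" "v \<in> V" "v \<in> D" "s v \<notin> A"
  shows "mass X w V s = 0"
proof -
  have "{t. t \<in> X \<and> (\<forall>v\<in>V. t v = s v)} = {}"
    using assms by (force dest: PiE_mem)
  then show ?thesis by (simp only: mass_def sum.empty)
qed

text \<open>The law of total probability: group the assignments by their value at
  \<open>x\<close>.\<close>

lemma mass_split:
  assumes "team D A X" "x \<in> D" "x \<notin> V"
  shows "mass X w V s = (\<Sum>a\<in>A. mass X w (insert x V) (s(x := a)))"
proof -
  let ?S = "{t. t \<in> X \<and> (\<forall>v\<in>V. t v = s v)}"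
  have fin: "finite ?S" "finite A" using assms(1) by (auto simp: team_def)
  have "(\<lambda>t. t x) ` ?S \<subseteq> A"
    using assms(1,2) by (auto simp: team_def dest: PiE_mem)
  then have "sum w ?S = (\<Sum>a\<in>A. sum w {t \<in> ?S. t x = a})"
    using sum.group[OF fin(1,2), of "\<lambda>t. t x" w] by simp
  also have "\<dots> = (\<Sum>a\<in>A. mass X w (insert x V) (s(x := a)))"
  proof (rule sum.cong[OF refl])
    fix a
    have "{t \<in> ?S. t x = a} = {t. t \<in> X \<and> (\<forall>v\<in>insert x V. t v = (s(x := a)) v)}"
      using assms(3) by auto
    then show "sum w {t \<in> ?S. t x = a} = mass X w (insert x V) (s(x := a))"
      by (simp only: mass_def)
  qed
  finally show ?thesis by (simp add: mass_def)
qed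

text \<open>If \<open>s\<close> stays in \<open>A\<close> on the variables of the atom, its
  restriction is one of the assignments in \<open>sat\<close>. Otherwise the joint mass and one of
  the two marginal masses vanish, and the identity reads 0 = 0.\<close>

lemma sat_Indep_iff:
  assumes "team D A X" "set ys \<subseteq> D" "set zs \<subseteq> D"
  shows "sat A X w (ys \<bottom>\<bottom> zs) \<longleftrightarrow> indep X w (set ys) (set zs)"
proof
  let ?V = "set ys" and ?W = "set zs"
  have X: "X \<subseteq> D \<rightarrow>\<^sub>E A" using assms(1) by (simp add: team_def)
  assume sat: "sat A X w (ys \<bottom>\<bottom> zs)"
  show "indep X w ?V ?W"
    unfolding indep_def
  proof
    fix s
    show "mass X w (?V \<union> ?W) s * total X w = mass X w ?V s * mass X w ?W s"
    proof (cases "\<forall>v\<in>?V \<union> ?W. s v \<in> A")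
      case True
      let ?s = "restrict s (?V \<union> ?W)"
      have "?s \<in> set (ys @ zs) \<rightarrow>\<^sub>E A" using True by auto
      with sat have "mass X w (set (ys @ zs)) ?s * total X w = mass X w ?V ?s * mass X w ?W ?s"
        unfolding sat.simps marginal_eq_mass by blast
      moreover have "mass X w (set (ys @ zs)) ?s = mass X w (?V \<union> ?W) s"
        "mass X w ?V ?s = mass X w ?V s" "mass X w ?W ?s = mass X w ?W s"
        by (auto intro!: mass_cong)
      ultimately show ?thesis by simp
    next
      case False
      then obtain v where v: "v \<in> ?V \<union> ?W" "s v \<notin> A" by blast
      then have "v \<in> D" using assms by blast
      then have "mass X w (?V \<union> ?W) s = 0" "mass X w ?V s = 0 \<or> mass X w ?W s = 0"
        using v mass_eq_0_outside[OF X] by (blast, blast)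
      then show ?thesis by auto
    qed
  qed
next
  assume "indep X w (set ys) (set zs)"
  then show "sat A X w (ys \<bottom>\<bottom> zs)"
    unfolding sat.simps marginal_eq_mass by (simp add: indep_def)
qed

section \<open>Independence rules valid over every commutative semiring\<close>

locale weighted_team =
  fixes D :: "'v set" and A :: "'a set" and X :: "('v \<Rightarrow> 'a) set"
    and w :: "('v \<Rightarrow> 'a) \<Rightarrow> 'k::comm_semiring_1"
  assumes team: "team D A X"
begin

lemma finite_X: "finite X" and finite_A: "finite A" and X_PiE: "X \<subseteq> D \<rightarrow>\<^sub>E A"
  using team by (auto simp: team_def)

lemma indep_commute: "indep X w V W \<Longrightarrow> indep X w W V"
  by (simp add: indep_def Un_commute mult.commute)

lemma indep_empty: "indep X w {} W"
  by (simp add: indep_def mass_empty mult.commute)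

text \<open>Sum the defining identity over all values at \<open>x\<close>. The mass on
  \<open>W\<close> does not depend on that value because \<open>x\<close> is outside
  \<open>W\<close>, so it factors out.\<close>

lemma indep_remove:
  assumes "indep X w (insert x V) W" "x \<in> D" "x \<notin> V" "x \<notin> W"
  shows "indep X w V W"
  unfolding indep_def
proof
  fix s
  have "mass X w (V \<union> W) s * total X w =
      (\<Sum>a\<in>A. mass X w (insert x V \<union> W) (s(x := a)) * total X w)"
    using mass_split[OF team, of x "V \<union> W" w s] assms by (simp add: sum_distrib_right)
  also have "\<dots> = (\<Sum>a\<in>A. mass X w (insert x V) (s(x := a)) * mass X w W (s(x := a)))"
    using assms(1) unfolding indep_def by metis
  also have "\<dots> = (\<Sum>a\<in>A. mass X w (insert x V) (s(x := a)) * mass X w W s)"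
    using assms(4)
    by (intro sum.cong refl arg_cong2[of _ _ _ _ "(*)"] mass_cong) auto
  also have "\<dots> = mass X w V s * mass X w W s"
    using mass_split[OF team, of x V w s] assms by (simp add: sum_distrib_right)
  finally show "mass X w (V \<union> W) s * total X w = mass X w V s * mass X w W s" .
qed

lemma indep_remove_set:
  assumes "finite U" "indep X w (V \<union> U) W" "U \<subseteq> D" "U \<inter> V = {}" "U \<inter> W = {}"
  shows "indep X w V W"
  using assms
proof (induction U rule: finite_induct)
  case (insert x U)
  then have "indep X w (V \<union> U) W"
    using indep_remove[of x "V \<union> U" W] by auto
  with insert show ?case by auto
qed simp

lemma indep_mono_left:
  assumes "indep X w V W" "finite V" "V \<subseteq> D" "V \<inter> W = {}" "V' \<subseteq> V"
  shows "indep X w V' W"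
proof (rule indep_remove_set[of "V - V'"])
  show "indep X w (V' \<union> (V - V')) W"
    using assms by (simp add: Un_absorb1)
qed (use assms in auto)

lemma indep_mono:
  assumes "indep X w V W" "finite V" "finite W" "V \<subseteq> D" "W \<subseteq> D" "V \<inter> W = {}" "V' \<subseteq> V" "W' \<subseteq> W"
  shows "indep X w V' W'"
proof -
  have "indep X w W V'" using indep_mono_left[of V W V'] assms indep_commute by blast
  then show ?thesis using indep_mono_left[of W V' W'] assms indep_commute by blast
qed

end

section \<open>Rules that use positivity and multiplicative cancellation\<close>

locale cancellative_team = weighted_team D A X w
  for D :: "'v set" and A :: "'a set" and X :: "('v \<Rightarrow> 'a) set"
    and w :: "('v \<Rightarrow> 'a) \<Rightarrow> 'k::comm_semiring_1" +
  assumes positive_add: "\<And>(a::'k) b. a + b = 0 \<Longrightarrow> a = 0 \<and> b = 0"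
    and cancel_mult: "\<And>(a::'k) b c. a \<noteq> 0 \<Longrightarrow> a * b = a * c \<Longrightarrow> b = c"
begin

lemma sum_eq_0_positive:
  assumes "finite S"
  shows "sum w S = 0 \<longleftrightarrow> (\<forall>s\<in>S. w s = 0)"
  using assms by (induction S rule: finite_induct) (auto dest: positive_add)

text \<open>By positivity nonzero weights never sum to zero, so the values with nonzero marginal are
  exactly those taken on the support.\<close>

lemma marginal_eq_0_iff: "marginal X w [x] [a] = 0 \<longleftrightarrow> a \<notin> (\<lambda>s. s x) ` supp X w"
  using finite_X by (auto simp: marginal_singleton sum_eq_0_positive supp_def)

lemma values_of_eq:
  assumes "x \<in> D"
  shows "values_of A X w x = (\<lambda>s. s x) ` supp X w"
proof -
  have "(\<lambda>s. s x) ` supp X w \<subseteq> A"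
    using X_PiE assms by (auto simp: supp_def dest: PiE_mem)
  then show ?thesis
    unfolding values_of_def marginal_eq_0_iff by blast
qed

lemma mass_eq_0_if_total_eq_0:
  assumes "total X w = 0"
  shows "mass X w V s = 0"
proof -
  have "\<forall>s\<in>X. w s = 0" using assms by (simp add: total_def sum_eq_0_positive finite_X)
  then show ?thesis by (simp add: mass_def)
qed

text \<open>Multiply the goal by the total weight, rewrite with the three premises, and cancel. If
  the total is zero, positivity makes every mass zero.\<close>

lemma indep_contraction:
  assumes "indep X w U V" "indep X w (U \<union> V) W" "indep X w V W"
  shows "indep X w U (V \<union> W)"
  unfolding indep_def
proof
  fix s
  let ?m = "\<lambda>V. mass X w V s" and ?t = "total X w"
  show "?m (U \<union> (V \<union> W)) * ?t = ?m U * ?m (V \<union> W)"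
  proof (cases "?t = 0")
    case True
    then show ?thesis by (simp add: mass_eq_0_if_total_eq_0)
  next
    case False
    have 1: "?m (U \<union> V) * ?t = ?m U * ?m V" "?m (U \<union> (V \<union> W)) * ?t = ?m (U \<union> V) * ?m W"
      "?m (V \<union> W) * ?t = ?m V * ?m W"
      using assms by (auto simp: indep_def Un_assoc)
    have "?t * (?m (U \<union> (V \<union> W)) * ?t) = (?m (U \<union> V) * ?t) * ?m W"
      using 1(2) by (simp add: ac_simps)
    also have "\<dots> = ?m U * (?m (V \<union> W) * ?t)"
      using 1(1,3) by (simp add: ac_simps)
    finally have "?t * (?m (U \<union> (V \<union> W)) * ?t) = ?t * (?m U * ?m (V \<union> W))"
      by (simp add: ac_simps)
    with False show ?thesis by (rule cancel_mult)
  qed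
qed

text \<open>All assignments in the support coincide on \<open>Z\<close>. Either they agree with
  \<open>s\<close> there, and the condition on \<open>Z\<close> changes no mass, or they all differ
  from \<open>s\<close>, and every mass involving \<open>Z\<close> is zero.\<close>

lemma indep_add_constant:
  assumes "indep X w V W" "\<forall>s\<in>supp X w. \<forall>s'\<in>supp X w. \<forall>z\<in>Z. s z = s' z"
  shows "indep X w V (W \<union> Z)"
  unfolding indep_def
proof
  fix s
  consider (all) "\<forall>t\<in>supp X w. \<forall>z\<in>Z. t z = s z" | (none) "\<forall>t\<in>supp X w. \<exists>z\<in>Z. t z \<noteq> s z"
    using assms(2) by metis
  then show "mass X w (V \<union> (W \<union> Z)) s * total X w = mass X w V s * mass X w (W \<union> Z) s"
  proof cases
    case all
    have "mass X w (S \<union> Z) s = mass X w S s" for S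
      unfolding mass_def using all finite_X
      by (intro sum.mono_neutral_left) (auto simp: supp_def)
    from this[of W] this[of "V \<union> W"] show ?thesis
      using assms(1) by (simp add: indep_def Un_assoc)
  next
    case none
    have "mass X w (S \<union> Z) s = 0" for S
      unfolding mass_def by (rule sum.neutral) (use none in \<open>auto simp: supp_def\<close>)
    from this[of W] this[of "V \<union> W"] show ?thesis
      by (simp add: Un_assoc)
  qed
qed

lemma finite_supp: "finite (supp X w)"
  using finite_X by (simp add: supp_def)

text \<open>The marginal multiset has one entry for each value taken on the support, so it alone
  decides constancy; hence \<open>\<approx>*\<close> transfers constancy. The bound is at most one
  because the support may be empty.\<close>

lemma sat_Constancy_singleton_iff:
  assumes "x \<in> D"
  shows "sat A X w (Constancy [x]) \<longleftrightarrow> size (marginal_mset A X w x) \<le> 1"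
proof -
  have "size (marginal_mset A X w x) = card ((\<lambda>s. s x) ` supp X w)"
    by (simp add: marginal_mset_def values_of_eq[OF assms])
  then show ?thesis
    using finite_supp by (auto simp: card_le_Suc0_iff_eq)
qed

text \<open>The right-hand side does not mention \<open>x\<close>, so any two constant variables
  satisfy \<open>\<approx>*\<close>.\<close>

lemma marginal_mset_constant:
  assumes "x \<in> D" "sat A X w (Constancy [x])"
  shows "marginal_mset A X w x = (if supp X w = {} then {#} else {#total X w#})"
proof (cases "supp X w = {}")
  case True
  then show ?thesis by (simp add: marginal_mset_def values_of_eq[OF assms(1)])
next
  case False
  then obtain s where s: "s \<in> supp X w" by blast
  then have "(\<lambda>s. s x) ` supp X w = {s x}" using assms(2) by auto
  moreover have "marginal X w [x] [s x] = total X w"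
    unfolding marginal_singleton total_def using assms(2) s finite_X
    by (intro sum.mono_neutral_left) (auto simp: supp_def)
  ultimately show ?thesis
    using False by (simp add: marginal_mset_def values_of_eq[OF assms(1)])
qed

lemma sat_UMI_imp_UMDE:
  assumes "sat A X w (x \<approx> y)"
  shows "sat A X w (x \<approx>* y)"
proof -
  have "values_of A X w x = values_of A X w y"
    using assms by (auto simp: values_of_def)
  then show ?thesis
    using assms finite_A by (auto simp: marginal_mset_def values_of_def intro!: image_mset_cong)
qed

lemma axiom_sound:
  assumes ax: "(\<Lambda>, \<Gamma>) \<in> axiom_instances D" and prem: "\<And>\<psi>. \<psi> \<in> \<Lambda> \<Longrightarrow> sat A X w \<psi>" and "\<phi> \<in> \<Gamma>"
  shows "sat A X w \<phi>"
proof -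
  have over: "\<And>\<psi>. \<psi> \<in> \<Lambda> \<union> \<Gamma> \<Longrightarrow> atom_over D \<psi>"
    and cases: "(\<Lambda>, \<Gamma>) \<in> ax_IA \<union> ax_IA_FD_1 \<union> ax_UCA_UMDE \<union> ax_UMI \<union> ax_UMDE \<union> ax_UMI_UMDE"
    using ax by (auto simp: axiom_instances_def)
  note ind = sat_Indep_iff[OF team, where w = w]
  consider "(\<Lambda>, \<Gamma>) \<in> ax_IA" | "(\<Lambda>, \<Gamma>) \<in> ax_IA_FD_1" | "(\<Lambda>, \<Gamma>) \<in> ax_UCA_UMDE"
    | "(\<Lambda>, \<Gamma>) \<in> ax_UMI" | "(\<Lambda>, \<Gamma>) \<in> ax_UMDE" | "(\<Lambda>, \<Gamma>) \<in> ax_UMI_UMDE"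
    using cases by blast
  then show ?thesis
  proof cases
    case 1
    then show ?thesis
      unfolding ax_IA_def
    proof (elim UnE CollectE exE conjE Pair_inject)
      fix xs assume triv: "\<Lambda> = {}" "\<Gamma> = {[] \<bottom>\<bottom> xs}"
      then show ?thesis
        using over[of "[] \<bottom>\<bottom> xs"] \<open>\<phi> \<in> \<Gamma>\<close> by (simp del: sat.simps add: ind indep_empty)
    next
      fix xs ys assume sym: "\<Lambda> = {xs \<bottom>\<bottom> ys}" "\<Gamma> = {ys \<bottom>\<bottom> xs}"
      then show ?thesis
        using over[of "xs \<bottom>\<bottom> ys"] \<open>\<phi> \<in> \<Gamma>\<close> prem[of "xs \<bottom>\<bottom> ys"]
        by (simp del: sat.simps add: ind indep_commute)
    next
      fix xs ys xs' ys'
      assume decomp: "\<Lambda> = {xs \<bottom>\<bottom> ys}" "\<Gamma> = {xs' \<bottom>\<bottom> ys'}"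
        "set xs' \<subseteq> set xs" "set ys' \<subseteq> set ys"
      then have o: "set xs \<subseteq> D" "set ys \<subseteq> D" "set xs \<inter> set ys = {}"
        using over[of "xs \<bottom>\<bottom> ys"] by auto
      have "indep X w (set xs) (set ys)"
        using prem[of "xs \<bottom>\<bottom> ys"] decomp(1) ind[OF o(1,2)] by (simp del: sat.simps)
      then have "indep X w (set xs') (set ys')"
        using indep_mono[of "set xs" "set ys"] o decomp(3,4) by simp
      then show ?thesis
        using ind[of xs' ys'] o decomp \<open>\<phi> \<in> \<Gamma>\<close> by (auto simp del: sat.simps)
    next
      fix xs ys zs
      assume contr: "\<Lambda> = {xs \<bottom>\<bottom> ys, (xs @ ys) \<bottom>\<bottom> zs}" "\<Gamma> = {xs \<bottom>\<bottom> (ys @ zs)}"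
      then have o: "set xs \<subseteq> D" "set ys \<subseteq> D" "set zs \<subseteq> D" "(set xs \<union> set ys) \<inter> set zs = {}"
        using over[of "xs \<bottom>\<bottom> ys"] over[of "(xs @ ys) \<bottom>\<bottom> zs"] by auto
      have i: "indep X w (set xs) (set ys)" "indep X w (set xs \<union> set ys) (set zs)"
        using prem[of "xs \<bottom>\<bottom> ys"] prem[of "(xs @ ys) \<bottom>\<bottom> zs"] contr(1) o ind[of xs ys] ind[of "xs @ ys" zs]
        by (simp_all del: sat.simps)
      moreover have "indep X w (set ys) (set zs)"
        \<comment> \<open>The third premise of \<open>indep_contraction\<close> is a decomposition
          of the second one; the disjointness of the tuples enters here.\<close>
        by (rule indep_mono[OF i(2)]) (use o in auto)
      ultimately have "indep X w (set xs) (set ys \<union> set zs)"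
        by (rule indep_contraction)
      then show ?thesis
        using ind[of xs "ys @ zs"] o contr \<open>\<phi> \<in> \<Gamma>\<close> by (simp del: sat.simps)
    qed
  next
    case 2
    then obtain xs ys zs where e: "\<Lambda> = {xs \<bottom>\<bottom> ys, Constancy zs}" "\<Gamma> = {xs \<bottom>\<bottom> (ys @ zs)}"
      unfolding ax_IA_FD_1_def by auto
    have o: "set xs \<subseteq> D" "set ys \<subseteq> D" "set zs \<subseteq> D"
      using over[of "xs \<bottom>\<bottom> ys"] over[of "Constancy zs"] e by auto
    have "indep X w (set xs) (set ys)"
      using prem[of "xs \<bottom>\<bottom> ys"] e(1) ind[OF o(1,2)] by (simp del: sat.simps)
    moreover have "\<forall>s\<in>supp X w. \<forall>s'\<in>supp X w. \<forall>z\<in>set zs. s z = s' z"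
      using prem[of "Constancy zs"] e(1) by simp
    ultimately have "indep X w (set xs) (set ys \<union> set zs)"
      by (rule indep_add_constant)
    then show ?thesis
      using ind[of xs "ys @ zs"] o e(2) \<open>\<phi> \<in> \<Gamma>\<close> by (simp del: sat.simps)
  next
    case 3
    then show ?thesis
      unfolding ax_UCA_UMDE_def
    proof (elim UnE CollectE exE conjE Pair_inject)
      fix x y assume const: "\<Lambda> = {x \<approx>* y, Constancy [y]}" "\<Gamma> = {Constancy [x]}"
      then have "x \<in> D" "y \<in> D" "sat A X w (x \<approx>* y)" "sat A X w (Constancy [y])"
        using over[of "x \<approx>* y"] prem by (auto simp del: sat.simps)
      then have "sat A X w (Constancy [x])"
        unfolding sat_Constancy_singleton_iff[OF \<open>x \<in> D\<close>] sat_Constancy_singleton_iff[OF \<open>y \<in> D\<close>]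
        by simp
      then show ?thesis using const \<open>\<phi> \<in> \<Gamma>\<close> by blast
    next
      fix x y assume equiv: "\<Lambda> = {Constancy [x], Constancy [y]}" "\<Gamma> = {x \<approx>* y}"
      then have "x \<in> D" "y \<in> D" "sat A X w (Constancy [x])" "sat A X w (Constancy [y])"
        using over[of "x \<approx>* y"] prem by (auto simp del: sat.simps)
      then have "sat A X w (x \<approx>* y)" by (simp add: marginal_mset_constant del: sat.simps(1))
      then show ?thesis using equiv \<open>\<phi> \<in> \<Gamma>\<close> by blast
    qed
  next
    case 4
    then show ?thesis using prem \<open>\<phi> \<in> \<Gamma>\<close> unfolding ax_UMI_def by fastforce
  next
    case 5
    then show ?thesis using prem \<open>\<phi> \<in> \<Gamma>\<close> unfolding ax_UMDE_def by fastforce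
  next
    case 6
    then show ?thesis using prem \<open>\<phi> \<in> \<Gamma>\<close> sat_UMI_imp_UMDE unfolding ax_UMI_UMDE_def by blast
  qed
qed

end

lemma soundness:
  fixes D :: "'v set"
  assumes "\<And>(a::'k::comm_semiring_1) b. a + b = 0 \<Longrightarrow> a = 0 \<and> b = 0"
    and "\<And>(a::'k) b c. a \<noteq> 0 \<Longrightarrow> a * b = a * c \<Longrightarrow> b = c"
    and "derives (axiom_instances D) \<Sigma> \<tau>"
  shows "entails TYPE('k) TYPE('a) D \<Sigma> \<tau>"
  unfolding entails_def
proof (intro allI impI)
  fix A :: "'a set" and X and w :: "('v \<Rightarrow> 'a) \<Rightarrow> 'k"
  assume "team D A X" and \<Sigma>: "\<forall>\<sigma>\<in>\<Sigma>. sat A X w \<sigma>"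
  then interpret cancellative_team D A X w
    using assms(1,2) by unfold_locales blast+
  show "sat A X w \<tau>"
    using assms(3) by (rule derives_sound) (use \<Sigma> axiom_sound in blast)+
qed

section \<open>Uniform teams\<close>

text \<open>A successor equal to zero would give 1 = 0 by positivity, which
  \<open>comm_semiring_1\<close> excludes; two successors are compared by cancelling 1. Identities
  between marginals of unit-weight teams thereby become identities between cardinalities.\<close>

lemma of_nat_eq_iff_cancellative:
  assumes "\<And>(a::'k::comm_semiring_1) b. a + b = 0 \<Longrightarrow> a = 0 \<and> b = 0"
    and "\<And>(a::'k) b c. a + b = a + c \<Longrightarrow> b = c"
  shows "(of_nat m :: 'k) = of_nat n \<longleftrightarrow> m = n"
proof (induction m arbitrary: n)
  case 0
  show ?case
  proof (cases n)
    case (Suc k)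
    have "of_nat (Suc k) \<noteq> (0::'k)"
      using assms(1)[of 1 "of_nat k"] by auto
    then show ?thesis using Suc by (metis Zero_not_Suc of_nat_0)
  qed simp
next
  case (Suc m)
  show ?case
  proof (cases n)
    case 0
    have "of_nat (Suc m) \<noteq> (0::'k)"
      using assms(1)[of 1 "of_nat m"] by auto
    then show ?thesis using 0 by (metis Zero_not_Suc of_nat_0)
  next
    case (Suc k)
    then show ?thesis using Suc.IH[of k] assms(2)[of 1 "of_nat m" "of_nat k"] by auto
  qed
qed

definition agree :: "('v \<Rightarrow> 'a) set \<Rightarrow> 'v set \<Rightarrow> ('v \<Rightarrow> 'a) \<Rightarrow> ('v \<Rightarrow> 'a) set" where
  "agree X V s = {t \<in> X. \<forall>v\<in>V. t v = s v}"

lemma agree_empty: "agree X {} s = X"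
  by (simp add: agree_def)

text \<open>What \<open>indep\<close> says when all weights are 1, with masses replaced by
  cardinalities.\<close>

definition count_indep :: "('v \<Rightarrow> 'a) set \<Rightarrow> 'v set \<Rightarrow> 'v set \<Rightarrow> bool" where
  "count_indep X V W \<longleftrightarrow>
     (\<forall>s. card (agree X (V \<union> W) s) * card X = card (agree X V s) * card (agree X W s))"

lemma count_indep_sym: "count_indep X V W \<Longrightarrow> count_indep X W V"
  by (simp add: count_indep_def Un_commute mult.commute)

text \<open>\<open>F x\<close> is the set of values of \<open>x\<close>, each taken by the same
  number of assignments. The multiplied form avoids division.\<close>

definition uniform :: "'v set \<Rightarrow> ('v \<Rightarrow> 'a set) \<Rightarrow> ('v \<Rightarrow> 'a) set \<Rightarrow> bool" where
  "uniform D F X \<longleftrightarrow> X \<subseteq> PiE D F \<and> X \<noteq> {} \<and>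
     (\<forall>x\<in>D. finite (F x) \<and> (\<forall>a\<in>F x. card (agree X {x} (\<lambda>_. a)) * card (F x) = card X))"

section \<open>Satisfaction of atoms in uniform teams with unit weights\<close>

locale uniform_team =
  fixes D :: "'v set" and F :: "'v \<Rightarrow> 'a set" and X :: "('v \<Rightarrow> 'a) set"
    and w :: "('v \<Rightarrow> 'a) \<Rightarrow> 'k::comm_semiring_1"
  assumes finite_D: "finite D" and uniform: "uniform D F X" and w: "w = (\<lambda>_. 1)"
    and of_nat_eq: "\<And>m n. (of_nat m :: 'k) = of_nat n \<longleftrightarrow> m = n"
begin

text \<open>A team has a single value set for all variables, so the sets \<open>F x\<close> are
  pooled.\<close>

definition A where "A = (\<Union>x\<in>D. F x)"

lemma team: "team D A X"
proof -
  have "X \<subseteq> PiE D F" and F: "\<And>x. x \<in> D \<Longrightarrow> finite (F x)" using uniform by (auto simp: uniform_def)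
  moreover have "finite (PiE D F)" using finite_D F by (simp add: finite_PiE)
  moreover have "PiE D F \<subseteq> D \<rightarrow>\<^sub>E A" by (intro PiE_mono) (auto simp: A_def)
  ultimately show ?thesis
    using finite_D by (auto simp: team_def A_def intro: finite_subset)
qed

lemma card_X_pos: "card X > 0"
  using team uniform by (auto simp: team_def uniform_def card_gt_0_iff)

lemma indep_iff: "indep X w V W \<longleftrightarrow> count_indep X V W"
  unfolding indep_def count_indep_def mass_def total_def w agree_def
  by (simp add: of_nat_eq flip: of_nat_mult)

lemma agree_uniform:
  assumes "x \<in> D"
  shows "card (agree X {x} (\<lambda>_. a)) = (if a \<in> F x then card X div card (F x) else 0)"
proof (cases "a \<in> F x")
  case True
  then have "card (agree X {x} (\<lambda>_. a)) * card (F x) = card X" and "finite (F x)"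
    using uniform assms by (auto simp: uniform_def)
  moreover have "card (F x) > 0" using \<open>finite (F x)\<close> True by (auto simp: card_gt_0_iff)
  ultimately have "card (agree X {x} (\<lambda>_. a)) = card X div card (F x)"
    by (metis div_mult_self_is_m)
  with True show ?thesis by simp
next
  case False
  have "X \<subseteq> PiE D F" using uniform by (auto simp: uniform_def)
  then have "agree X {x} (\<lambda>_. a) = {}"
    using False assms by (auto simp: agree_def)
  with False show ?thesis by simp
qed

lemma div_card_pos:
  assumes "x \<in> D" "a \<in> F x"
  shows "card X div card (F x) > 0"
proof -
  have "card (agree X {x} (\<lambda>_. a)) * card (F x) = card X"
    using uniform assms by (auto simp: uniform_def)
  then have "card X div card (F x) * card (F x) > 0"
    using card_X_pos agree_uniform[OF assms(1), of a] assms(2) by simp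
  then show ?thesis by (simp only: nat_0_less_mult_iff)
qed

lemma marginal_uniform:
  assumes "x \<in> D"
  shows "marginal X w [x] [a] = of_nat (if a \<in> F x then card X div card (F x) else 0)"
  using agree_uniform[OF assms, of a] by (simp add: marginal_singleton w agree_def)

lemma marginal_uniform_eq_0_iff:
  assumes "x \<in> D"
  shows "marginal X w [x] [a] = 0 \<longleftrightarrow> a \<notin> F x"
  using of_nat_eq[of _ 0] div_card_pos[OF assms] by (auto simp: marginal_uniform[OF assms])

lemma marginal_mset_uniform:
  assumes "x \<in> D"
  shows "marginal_mset A X w x = replicate_mset (card (F x)) (of_nat (card X div card (F x)))"
proof -
  have v: "values_of A X w x = F x"
    using assms marginal_uniform_eq_0_iff[OF assms] by (auto simp: values_of_def A_def)
  have "finite (F x)" using uniform assms by (simp add: uniform_def)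
  then have "marginal_mset A X w x = image_mset (\<lambda>_. of_nat (card X div card (F x))) (mset_set (F x))"
    unfolding marginal_mset_def v
    by (intro image_mset_cong) (simp add: marginal_uniform[OF assms])
  then show ?thesis by (simp add: image_mset_const_eq)
qed

text \<open>In a uniform team the number of values of a variable determines the common weight of
  each value, hence the whole marginal multiset; conversely it is the size of that multiset.\<close>

lemma sat_UMDE_uniform_iff:
  assumes "x \<in> D" "y \<in> D"
  shows "sat A X w (x \<approx>* y) \<longleftrightarrow> card (F x) = card (F y)"
  using marginal_mset_uniform[OF assms(1)] marginal_mset_uniform[OF assms(2)]
  by (metis sat.simps(4) size_replicate_mset)

text \<open>\<open>F x\<close> is recovered as the set of values with nonzero marginal, and it
  determines the common weight of these values.\<close>

lemma sat_UMI_uniform_iff: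
  assumes "x \<in> D" "y \<in> D"
  shows "sat A X w (x \<approx> y) \<longleftrightarrow> F x = F y"
proof
  assume "sat A X w (x \<approx> y)"
  then have "\<forall>a\<in>A. a \<in> F x \<longleftrightarrow> a \<in> F y"
    using marginal_uniform_eq_0_iff[OF assms(1)] marginal_uniform_eq_0_iff[OF assms(2)]
    by (metis sat.simps(3))
  then show "F x = F y" using assms by (auto simp: A_def)
qed (simp add: marginal_uniform assms)

text \<open>Every value in \<open>F x\<close> is attained on the support, which is all of the
  nonempty set \<open>X\<close>.\<close>

lemma sat_Constancy_uniform_iff:
  assumes "x \<in> D"
  shows "sat A X w (Constancy [x]) \<longleftrightarrow> card (F x) = 1"
proof -
  have X: "X \<subseteq> PiE D F" "X \<noteq> {}" using uniform by (auto simp: uniform_def)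
  have "a \<in> (\<lambda>s. s x) ` X" if "a \<in> F x" for a
  proof -
    have "agree X {x} (\<lambda>_. a) \<noteq> {}"
      using agree_uniform[OF assms, of a] div_card_pos[OF assms that] that by force
    then show ?thesis by (auto simp: agree_def)
  qed
  then have "F x = (\<lambda>s. s x) ` X" using X assms by auto
  moreover have "supp X w = X" by (simp add: supp_def w)
  ultimately have F_x: "F x = (\<lambda>s. s x) ` supp X w" and "supp X w \<noteq> {}" using X(2) by auto
  then obtain s where s: "s \<in> supp X w" by blast
  show ?thesis
  proof
    assume "sat A X w (Constancy [x])"
    then have "F x = {s x}" using F_x s by auto
    then show "card (F x) = 1" by simp
  next
    assume "card (F x) = 1"
    then obtain a where "F x = {a}" by (auto simp: card_1_singleton_iff)
    then have "s' x = a" if "s' \<in> supp X w" for s' using F_x that by blast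
    then show "sat A X w (Constancy [x])" unfolding sat.simps list.map by metis
  qed
qed

end

section \<open>Product and parity teams\<close>

lemma card_agree_PiE:
  assumes "finite D" "V \<subseteq> D"
  shows "card (agree (PiE D F) V s) = (\<Prod>v\<in>D. card (if v \<in> V then F v \<inter> {s v} else F v))"
proof -
  have "agree (PiE D F) V s = (\<Pi>\<^sub>E v\<in>D. if v \<in> V then F v \<inter> {s v} else F v)"
    using assms(2) by (auto simp: agree_def PiE_iff extensional_def split: if_splits)
  then show ?thesis by (simp add: card_PiE assms(1))
qed

text \<open>All four counts are products over \<open>D\<close>, and the two sides agree factor by
  factor: as \<open>V\<close> and \<open>W\<close> are disjoint, each variable in them is pinned in
  exactly one count on either side.\<close>

lemma count_indep_PiE:
  assumes "finite D" "V \<subseteq> D" "W \<subseteq> D" "V \<inter> W = {}"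
  shows "count_indep (PiE D F) V W"
  unfolding count_indep_def
proof
  fix s
  \<comment> \<open>The full product is written as \<open>agree\<close> on the empty set so that the
    same product formula covers every count.\<close>
  have "card (agree (PiE D F) (V \<union> W) s) * card (agree (PiE D F) {} s)
      = card (agree (PiE D F) V s) * card (agree (PiE D F) W s)"
    using assms by (auto simp: card_agree_PiE simp flip: prod.distrib intro!: prod.cong)
  then show "card (agree (PiE D F) (V \<union> W) s) * card (PiE D F)
      = card (agree (PiE D F) V s) * card (agree (PiE D F) W s)"
    by (simp add: agree_empty)
qed

lemma card_agree_PiE_singleton:
  assumes "finite D" "x \<in> D" "a \<in> F x"
  shows "card (agree (PiE D F) {x} (\<lambda>_. a)) * card (F x) = card (PiE D F)"
  using assms by (simp add: card_agree_PiE card_PiE prod.remove[of D x])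

lemma uniform_PiE:
  assumes "finite D" "\<And>x. x \<in> D \<Longrightarrow> finite (F x) \<and> F x \<noteq> {}"
  shows "uniform D F (PiE D F)"
  using assms card_agree_PiE_singleton[OF assms(1)] by (auto simp: uniform_def PiE_eq_empty_iff)

section \<open>Parity teams\<close>

definition even_team :: "'v set \<Rightarrow> ('v \<Rightarrow> 'a set) \<Rightarrow> 'v set \<Rightarrow> 'a \<Rightarrow> ('v \<Rightarrow> 'a) set" where
  "even_team D F U b = {t \<in> PiE D F. even (card {u \<in> U. t u = b})}"

text \<open>On \<open>U\<close> every variable is a bit, with \<open>b\<close> as one and
  \<open>c\<close> as zero; outside \<open>U\<close> the ranges are arbitrary finite nonempty
  sets.\<close>

locale parity =
  fixes D :: "'v set" and F :: "'v \<Rightarrow> 'a set" and U :: "'v set" and b c :: 'a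
  assumes finite_D: "finite D" and U_D: "U \<subseteq> D" and F_U: "\<And>u. u \<in> U \<Longrightarrow> F u = {c, b}"
    and b_neq_c: "b \<noteq> c"
    and F: "\<And>x. x \<in> D \<Longrightarrow> finite (F x) \<and> F x \<noteq> {}"
begin

abbreviation "X \<equiv> even_team D F U b"

lemma finite_U: "finite U"
  using finite_D U_D by (rule rev_finite_subset)

text \<open>The parity constraint solved for the bit at \<open>u\<close>.\<close>

lemma even_card_remove:
  assumes "u \<in> U"
  shows "even (card {v \<in> U. t v = b}) \<longleftrightarrow> (t u = b \<longleftrightarrow> odd (card {v \<in> U - {u}. t v = b}))"
proof (cases "t u = b")
  case True
  then have "{v \<in> U. t v = b} = insert u {v \<in> U - {u}. t v = b}" using assms by auto
  then show ?thesis using True finite_U by simp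
next
  case False
  then have "{v \<in> U. t v = b} = {v \<in> U - {u}. t v = b}" using assms by auto
  then show ?thesis using False by simp
qed

text \<open>The parity constraint determines the value at \<open>u\<close>, so it is invisible on the other variables.\<close>

lemma card_agree_even_team:
  assumes "u \<in> U" "u \<notin> V"
  shows "card (agree X V s) = card (agree (PiE (D - {u}) F) V s)"
proof -
  \<comment> \<open>\<open>g\<close> sets at \<open>u\<close> the unique bit that makes the number
    of ones on \<open>U\<close> even; it inverts forgetting the value at \<open>u\<close>.\<close>
  define g where "g t = t(u := if odd (card {v \<in> U - {u}. t v = b}) then b else c)" for t
  have u: "u \<in> D" using assms U_D by blast
  have odd_upd: "{v \<in> U - {u}. (t(u := z)) v = b} = {v \<in> U - {u}. t v = b}" for t z
    by auto
  have gX: "g t \<in> X" if "t \<in> PiE (D - {u}) F" for t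
  proof -
    have "g t \<in> PiE D F"
      using that u F_U[OF assms(1)] by (auto simp: g_def PiE_iff extensional_def)
    moreover have "even (card {v \<in> U. g t v = b})"
      using even_card_remove[OF assms(1), of "g t"] odd_upd[of t] b_neq_c by (auto simp: g_def)
    ultimately show ?thesis by (simp add: even_team_def)
  qed
  have "bij_betw (\<lambda>t. restrict t (D - {u})) (agree X V s) (agree (PiE (D - {u}) F) V s)"
  proof (rule bij_betw_byWitness[where f' = g])
    show "\<forall>t\<in>agree X V s. g (restrict t (D - {u})) = t"
    proof
      fix t assume "t \<in> agree X V s"
      then have t: "t \<in> PiE D F" "even (card {v \<in> U. t v = b})"
        by (auto simp: agree_def even_team_def)
      have e: "{v \<in> U - {u}. restrict t (D - {u}) v = b} = {v \<in> U - {u}. t v = b}"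
        using U_D by auto
      have tu: "t u \<in> {c, b}" using t(1) u F_U[OF assms(1)] by (metis PiE_mem)
      show "g (restrict t (D - {u})) = t"
      proof
        fix v
        show "g (restrict t (D - {u})) v = t v"
        proof (cases "v = u")
          case True
          then show ?thesis
            using even_card_remove[OF assms(1), of t] t(2) tu b_neq_c unfolding g_def e by auto
        next
          case False
          then show ?thesis using t(1) by (auto simp: g_def PiE_iff extensional_def)
        qed
      qed
    qed
    show "\<forall>t\<in>agree (PiE (D - {u}) F) V s. restrict (g t) (D - {u}) = t"
      by (auto simp: agree_def g_def PiE_iff extensional_def)
    show "(\<lambda>t. restrict t (D - {u})) ` agree X V s \<subseteq> agree (PiE (D - {u}) F) V s"
    proof
      fix r assume "r \<in> (\<lambda>t. restrict t (D - {u})) ` agree X V s"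
      then obtain t where t: "t \<in> PiE D F" "\<forall>v\<in>V. t v = s v" and r: "r = restrict t (D - {u})"
        by (auto simp: agree_def even_team_def)
      have "r v = t v" if "v \<in> V" for v
        using that assms(2) t(1) r by (auto simp: PiE_iff extensional_def)
      then show "r \<in> agree (PiE (D - {u}) F) V s"
        using t r by (auto simp: agree_def)
    qed
    show "g ` agree (PiE (D - {u}) F) V s \<subseteq> agree X V s"
    proof
      fix r assume "r \<in> g ` agree (PiE (D - {u}) F) V s"
      then obtain t where t: "t \<in> PiE (D - {u}) F" "\<forall>v\<in>V. t v = s v" and r: "r = g t"
        by (auto simp: agree_def)
      have "r v = t v" if "v \<in> V" for v
        using that assms(2) r by (auto simp: g_def)
      then show "r \<in> agree X V s"
        using t r gX by (auto simp: agree_def)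
    qed
  qed
  then show ?thesis by (rule bij_betw_same_card)
qed

lemma card_even_team: "u \<in> U \<Longrightarrow> card X = card (PiE (D - {u}) F)"
  using card_agree_even_team[of u "{}"] by (simp add: agree_empty)

text \<open>Agreement with \<open>s\<close> on all of \<open>U\<close> fixes the parity, so the
  constraint keeps either all of these assignments or none.\<close>

lemma card_agree_even_team_superset:
  assumes "U \<subseteq> V"
  shows "card (agree X V s) =
    (if even (card {u \<in> U. s u = b}) then card (agree (PiE D F) V s) else 0)"
proof -
  have "t \<in> agree X V s \<longleftrightarrow> t \<in> agree (PiE D F) V s \<and> even (card {u \<in> U. s u = b})" for t
  proof (cases "\<forall>v\<in>V. t v = s v")
    case True
    then have "{u \<in> U. t u = b} = {u \<in> U. s u = b}" using assms by auto
    with True show ?thesis by (simp add: agree_def even_team_def)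
  next
    case False
    then show ?thesis by (auto simp: agree_def)
  qed
  then have "agree X V s = (if even (card {u \<in> U. s u = b}) then agree (PiE D F) V s else {})"
    by auto
  then show ?thesis by simp
qed

text \<open>If \<open>s\<close> has odd parity on \<open>U\<close>, both sides vanish. Otherwise the
  counts for \<open>V\<close> and \<open>V \<union> W\<close> are those of the full product, while
  \<open>W\<close> misses some \<open>u\<close> in \<open>U\<close>, so its count and the total are
  those of the product without \<open>u\<close>. Splitting off the factor at \<open>u\<close> leaves
  independence in that product.\<close>

lemma count_indep_even_team_superset:
  assumes "U \<noteq> {}" "U \<subseteq> V" "V \<subseteq> D" "W \<subseteq> D" "V \<inter> W = {}"
  shows "count_indep X V W"
  unfolding count_indep_def
proof
  fix s
  obtain u where u: "u \<in> U" using assms(1) by blast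
  let ?e = "\<lambda>V. card (agree X V s)" and ?p = "\<lambda>V. card (agree (PiE D F) V s)"
    and ?q = "\<lambda>V. card (agree (PiE (D - {u}) F) V s)"
  have p: "?p S = card (F u \<inter> {s u}) * ?q (S - {u})" if "u \<in> S" "S \<subseteq> D" for S
  proof -
    have "S - {u} \<subseteq> D - {u}" using that by blast
    then show ?thesis
      using that finite_D by (auto simp: card_agree_PiE prod.remove[of D u] intro!: prod.cong)
  qed
  have uV: "u \<in> V" "u \<notin> W" using u assms by auto
  have "count_indep (PiE (D - {u}) F) (V - {u}) W"
    by (rule count_indep_PiE) (use finite_D assms uV in auto)
  then have *: "?q (V - {u} \<union> W) * card X = ?q (V - {u}) * ?e W"
    using card_agree_even_team[OF u uV(2)] card_even_team[OF u] by (simp add: count_indep_def)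
  have "V \<union> W - {u} = V - {u} \<union> W" using uV by auto
  then have "?p (V \<union> W) * card X = ?p V * ?e W"
    using p[of V] p[of "V \<union> W"] uV assms * by simp
  then show "?e (V \<union> W) * card X = ?e V * ?e W"
    using card_agree_even_team_superset[of V s] card_agree_even_team_superset[of "V \<union> W" s] assms
    by (simp add: le_supI1)
qed

text \<open>All four counts miss \<open>u\<close>, so they are counts in the product without
  \<open>u\<close>.\<close>

lemma count_indep_even_team_missing:
  assumes "u \<in> U" "u \<notin> V \<union> W" "V \<subseteq> D" "W \<subseteq> D" "V \<inter> W = {}"
  shows "count_indep X V W"
proof -
  have "count_indep (PiE (D - {u}) F) V W"
    by (rule count_indep_PiE) (use finite_D assms in auto)
  then show ?thesis
    using assms card_agree_even_team[OF assms(1)] card_even_team[OF assms(1)]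
    by (simp add: count_indep_def)
qed

text \<open>The last assumption excludes exactly the pairs that divide \<open>U\<close> into two
  nonempty parts. Any other pair misses a variable of \<open>U\<close> or has \<open>U\<close> on
  one side.\<close>

lemma count_indep_even_team:
  assumes "U \<noteq> {}" "V \<subseteq> D" "W \<subseteq> D" "V \<inter> W = {}" "U \<subseteq> V \<union> W \<Longrightarrow> U \<subseteq> V \<or> U \<subseteq> W"
  shows "count_indep X V W"
proof -
  consider "U \<subseteq> V" | "U \<subseteq> W" | u where "u \<in> U" "u \<notin> V \<union> W" using assms(5) by blast
  then show ?thesis
  proof cases
    case 1
    then show ?thesis using count_indep_even_team_superset assms by simp
  next
    case 2
    then have "count_indep X W V"
      using count_indep_even_team_superset[of W V] assms by (simp add: Int_commute)
    then show ?thesis by (rule count_indep_sym)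
  next
    case 3
    then show ?thesis using count_indep_even_team_missing assms by simp
  qed
qed

lemma card_agree_PiE_pos:
  assumes "V \<subseteq> D" "\<And>v. v \<in> V \<Longrightarrow> s v \<in> F v"
  shows "card (agree (PiE (D - {u}) F) (V - {u}) s) > 0"
proof -
  have "V - {u} \<subseteq> D - {u}" using assms by blast
  then show ?thesis
    using assms finite_D F by (auto simp: card_agree_PiE card_gt_0_iff intro!: prod_pos)
qed

lemma even_team_nonempty:
  assumes "U \<noteq> {}"
  shows "X \<noteq> {}"
proof -
  obtain u where "u \<in> U" using assms by blast
  then have "card X > 0"
    using card_even_team card_agree_PiE_pos[of "{}" _ u] by (simp add: agree_empty)
  then show ?thesis by auto
qed

text \<open>Take bits with a single one on \<open>U\<close>. Their parity is odd, so no assignment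
  matches them on \<open>V \<union> W\<close>; but each of \<open>V\<close> and \<open>W\<close>
  misses a variable of \<open>U\<close>, so both marginal counts are positive.\<close>

lemma not_count_indep_even_team:
  assumes "U = V \<union> W" "V \<inter> W = {}" "V \<noteq> {}" "W \<noteq> {}"
  shows "\<not> count_indep X V W"
proof
  assume i: "count_indep X V W"
  obtain v v' where v: "v \<in> V" "v' \<in> W" using assms by blast
  define s where "s = (\<lambda>u. if u = v then b else c)"
  have "{u \<in> U. s u = b} = {v}" using v assms b_neq_c by (auto simp: s_def)
  then have "card (agree X (V \<union> W) s) = 0"
    using card_agree_even_team_superset[of "V \<union> W" s] assms by simp
  moreover have "v' \<notin> V" "v \<notin> W" using v assms(2) by auto
  moreover have "s u \<in> F u" if "u \<in> U" for u using F_U[OF that] by (simp add: s_def)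
  then have "card (agree X V s) > 0" "card (agree X W s) > 0"
    using card_agree_even_team[of v' V s] card_agree_even_team[of v W s]
      card_agree_PiE_pos[of V s v'] card_agree_PiE_pos[of W s v] v assms(1) U_D \<open>v' \<notin> V\<close> \<open>v \<notin> W\<close>
    by simp_all
  ultimately show False
    using i unfolding count_indep_def by (metis mult_0 mult_pos_pos less_irrefl)
qed

text \<open>The assumption says that \<open>U\<close> has at least two elements, so for each
  \<open>x\<close> some other variable of \<open>U\<close> can absorb the parity constraint. A
  single variable in \<open>U\<close> would be forced to the value \<open>c\<close>.\<close>

lemma uniform_even_team:
  assumes "\<And>x. \<exists>u\<in>U. u \<noteq> x"
  shows "uniform D F X"
  unfolding uniform_def
proof (intro conjI ballI)
  show "X \<subseteq> PiE D F" by (auto simp: even_team_def)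
  show "X \<noteq> {}" using assms even_team_nonempty by auto
  fix x assume x: "x \<in> D"
  then show "finite (F x)" using F by blast
  fix a assume a: "a \<in> F x"
  obtain u where u: "u \<in> U" "u \<noteq> x" using assms by blast
  have "card (agree (PiE (D - {u}) F) {x} (\<lambda>_. a)) * card (F x) = card (PiE (D - {u}) F)"
    by (rule card_agree_PiE_singleton) (use finite_D x u a in auto)
  then show "card (agree X {x} (\<lambda>_. a)) * card (F x) = card X"
    using card_agree_even_team[of u "{x}"] card_even_team[of u] u by simp
qed

end

section \<open>Completeness\<close>

locale deduction =
  fixes D :: "'v set" and \<Sigma> :: "'v atom set"
  assumes finite_D: "finite D" and \<Sigma>: "\<Sigma> \<subseteq> IA_UCA_UMI_UMDE_atoms D"
begin

abbreviation der :: "'v atom \<Rightarrow> bool" where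
  "der \<equiv> derives (axiom_instances D) \<Sigma>"

abbreviation const :: "'v \<Rightarrow> bool" where
  "const x \<equiv> der (Constancy [x])"

text \<open>Derivability of an independence atom as a relation between sets; by decomposition the
  choice of listing is immaterial.\<close>

definition der_indep :: "'v set \<Rightarrow> 'v set \<Rightarrow> bool" where
  "der_indep V W \<longleftrightarrow> (\<exists>xs ys. set xs = V \<and> set ys = W \<and> der (xs \<bottom>\<bottom> ys))"

lemma der_over:
  assumes "der \<phi>"
  shows "atom_over D \<phi>"
  using assms
proof (rule derives_sound)
  show "atom_over D \<phi>" if "\<phi> \<in> \<Sigma>" for \<phi> using that \<Sigma> by (auto simp: IA_UCA_UMI_UMDE_atoms_def)
  show "atom_over D \<phi>" if "(\<Lambda>, \<Gamma>) \<in> axiom_instances D" "\<phi> \<in> \<Gamma>" for \<Lambda> \<Gamma> \<phi>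
    using that by (auto simp: axiom_instances_def)
qed

text \<open>Derivable premises are automatically over \<open>D\<close>, so only the conclusion has
  to be checked.\<close>

lemma der_axiom:
  assumes "(\<Lambda>, {\<phi>}) \<in> ax_IA \<union> ax_IA_FD_1 \<union> ax_UCA_UMDE \<union> ax_UMI \<union> ax_UMDE \<union> ax_UMI_UMDE"
    and "atom_over D \<phi>" "finite \<Lambda>" "\<And>\<psi>. \<psi> \<in> \<Lambda> \<Longrightarrow> der \<psi>"
  shows "der \<phi>"
proof (rule derives_step)
  show "(\<Lambda>, {\<phi>}) \<in> axiom_instances D"
    using assms der_over by (auto simp: axiom_instances_def)
qed (use assms in auto)

section \<open>Derived rules for the marginal atoms\<close>

lemma der_UMI_refl: "x \<in> D \<Longrightarrow> der (x \<approx> x)"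
  by (rule der_axiom[of "{}"]) (auto simp: ax_UMI_def)

lemma der_UMI_sym: "der (x \<approx> y) \<Longrightarrow> der (y \<approx> x)"
  by (rule der_axiom[of "{x \<approx> y}"]) (auto simp: ax_UMI_def dest: der_over)

lemma der_UMI_trans: "der (x \<approx> y) \<Longrightarrow> der (y \<approx> z) \<Longrightarrow> der (x \<approx> z)"
  by (rule der_axiom[of "{x \<approx> y, y \<approx> z}"]) (auto simp: ax_UMI_def dest: der_over)

lemma der_UMDE_refl: "x \<in> D \<Longrightarrow> der (x \<approx>* x)"
  by (rule der_axiom[of "{}"]) (auto simp: ax_UMDE_def)

lemma der_UMDE_sym: "der (x \<approx>* y) \<Longrightarrow> der (y \<approx>* x)"
  by (rule der_axiom[of "{x \<approx>* y}"]) (auto simp: ax_UMDE_def dest: der_over)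

lemma der_UMDE_trans: "der (x \<approx>* y) \<Longrightarrow> der (y \<approx>* z) \<Longrightarrow> der (x \<approx>* z)"
  by (rule der_axiom[of "{x \<approx>* y, y \<approx>* z}"]) (auto simp: ax_UMDE_def dest: der_over)

lemma der_UMI_imp_UMDE: "der (x \<approx> y) \<Longrightarrow> der (x \<approx>* y)"
  by (rule der_axiom[of "{x \<approx> y}"]) (auto simp: ax_UMI_UMDE_def dest: der_over)

lemma const_imp_UMDE: "const x \<Longrightarrow> const y \<Longrightarrow> der (x \<approx>* y)"
  by (rule der_axiom[of "{Constancy [x], Constancy [y]}"]) (auto simp: ax_UCA_UMDE_def dest: der_over)

lemma UMDE_const: "der (x \<approx>* y) \<Longrightarrow> const y \<Longrightarrow> const x"
  by (rule der_axiom[of "{x \<approx>* y, Constancy [y]}"]) (auto simp: ax_UCA_UMDE_def dest: der_over)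

lemma UMDE_const_iff: "der (x \<approx>* y) \<Longrightarrow> const x \<longleftrightarrow> const y"
  using UMDE_const der_UMDE_sym by blast

section \<open>Derived rules for independence between sets of variables\<close>

lemma ax_IA_decomposition:
  "set xs' \<subseteq> set xs \<Longrightarrow> set ys' \<subseteq> set ys \<Longrightarrow> ({xs \<bottom>\<bottom> ys}, {xs' \<bottom>\<bottom> ys'}) \<in> ax_IA"
  unfolding ax_IA_def by (rule UnI1, rule UnI2) blast

lemma ax_IA_symmetry: "({xs \<bottom>\<bottom> ys}, {ys \<bottom>\<bottom> xs}) \<in> ax_IA"
  unfolding ax_IA_def by (rule UnI1, rule UnI1, rule UnI2) blast

lemma ax_IA_contraction:
  "({xs \<bottom>\<bottom> ys, (xs @ ys) \<bottom>\<bottom> zs}, {xs \<bottom>\<bottom> (ys @ zs)}) \<in> ax_IA"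
  unfolding ax_IA_def by (rule UnI2) blast

lemma der_indepD:
  assumes "der_indep V W"
  shows "V \<subseteq> D" "W \<subseteq> D" "V \<inter> W = {}"
  using assms der_over by (force simp: der_indep_def)+

text \<open>The decomposition axiom looks only at sets of variables, so it also permutes a tuple and
  adds or removes repetitions.\<close>

lemma der_indep_mono:
  assumes "der_indep V W" "V' \<subseteq> V" "W' \<subseteq> W" "set xs' = V'" "set ys' = W'"
  shows "der (xs' \<bottom>\<bottom> ys')"
proof -
  obtain xs ys where e: "set xs = V" "set ys = W" "der (xs \<bottom>\<bottom> ys)"
    using assms(1) by (auto simp: der_indep_def)
  have o: "atom_over D (xs' \<bottom>\<bottom> ys')" using der_indepD[OF assms(1)] assms(2-) by auto
  show ?thesis
    by (rule der_axiom[of "{xs \<bottom>\<bottom> ys}"])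
      (use e o assms(2-) in \<open>auto simp: ax_IA_decomposition\<close>)
qed

lemma der_indep_set: "der_indep (set xs) (set ys) \<Longrightarrow> der (xs \<bottom>\<bottom> ys)"
  using der_indep_mono by blast

lemma der_imp_der_indep: "der (xs \<bottom>\<bottom> ys) \<Longrightarrow> der_indep (set xs) (set ys)"
  by (auto simp: der_indep_def)

lemma der_indep_subset:
  assumes "der_indep V W" "V' \<subseteq> V" "W' \<subseteq> W"
  shows "der_indep V' W'"
proof -
  have "finite V'" "finite W'"
    using der_indepD[OF assms(1)] assms finite_D by (meson finite_subset)+
  then obtain xs ys where "set xs = V'" "set ys = W'" by (meson finite_list)
  then show ?thesis using der_indep_mono[OF assms] der_imp_der_indep by blast
qed

lemma der_indep_empty:
  assumes "W \<subseteq> D"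
  shows "der_indep {} W"
proof -
  obtain ys where ys: "set ys = W" using assms finite_D by (meson finite_list finite_subset)
  have "der ([] \<bottom>\<bottom> ys)"
    by (rule der_axiom[of "{}"]) (use ys assms in \<open>auto simp: ax_IA_def\<close>)
  then show ?thesis using der_imp_der_indep ys by force
qed

lemma der_indep_sym:
  assumes "der_indep V W"
  shows "der_indep W V"
proof -
  obtain xs ys where e: "set xs = V" "set ys = W" "der (xs \<bottom>\<bottom> ys)"
    using assms by (auto simp: der_indep_def)
  have "der (ys \<bottom>\<bottom> xs)"
    by (rule der_axiom[of "{xs \<bottom>\<bottom> ys}"]) (use e der_indepD[OF assms] in \<open>auto simp: ax_IA_symmetry\<close>)
  then show ?thesis using der_imp_der_indep e by blast
qed

lemma der_indep_contraction:
  assumes "der_indep U V" "der_indep (U \<union> V) W"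
  shows "der_indep U (V \<union> W)"
proof -
  obtain xs ys where e: "set xs = U" "set ys = V" "der (xs \<bottom>\<bottom> ys)"
    using assms(1) by (auto simp: der_indep_def)
  obtain zs where z: "set zs = W" using assms(2) by (auto simp: der_indep_def)
  have c: "der ((xs @ ys) \<bottom>\<bottom> zs)" using der_indep_set[of "xs @ ys" zs] e z assms(2) by simp
  have "der (xs \<bottom>\<bottom> (ys @ zs))"
    by (rule der_axiom[of "{xs \<bottom>\<bottom> ys, (xs @ ys) \<bottom>\<bottom> zs}"])
      (use e z c der_indepD[OF assms(1)] der_indepD[OF assms(2)] in \<open>auto simp: ax_IA_contraction\<close>)
  then show ?thesis using der_imp_der_indep e z by force
qed

text \<open>The instance of \<open>ax_IA_FD_1\<close> for one variable; \<open>z \<notin> V\<close>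
  keeps the tuples of the conclusion disjoint.\<close>

lemma der_indep_insert_const:
  assumes "der_indep V W" "const z" "z \<notin> V"
  shows "der_indep V (insert z W)"
proof -
  obtain xs ys where e: "set xs = V" "set ys = W" "der (xs \<bottom>\<bottom> ys)"
    using assms(1) by (auto simp: der_indep_def)
  have "der (xs \<bottom>\<bottom> (ys @ [z]))"
    by (rule der_axiom[of "{xs \<bottom>\<bottom> ys, Constancy [z]}"])
      (use e assms der_indepD[OF assms(1)] der_over[OF assms(2)] in \<open>auto simp: ax_IA_FD_1_def\<close>)
  then show ?thesis using der_imp_der_indep[of xs "ys @ [z]"] e by simp
qed

section \<open>Minimal underivable independence atoms\<close>

definition minimal_underivable :: "'v set \<Rightarrow> 'v set \<Rightarrow> bool" where
  "minimal_underivable V W \<longleftrightarrow> V \<subseteq> D \<and> W \<subseteq> D \<and> V \<inter> W = {} \<and> \<not> der_indep V W \<and>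
     (\<forall>V'\<subseteq>V. \<forall>W'\<subseteq>W. V' \<noteq> V \<or> W' \<noteq> W \<longrightarrow> der_indep V' W')"

lemma minimal_underivable_exists:
  assumes "V \<subseteq> D" "W \<subseteq> D" "V \<inter> W = {}" "\<not> der_indep V W"
  shows "\<exists>V'\<subseteq>V. \<exists>W'\<subseteq>W. minimal_underivable V' W'"
  using assms
proof (induction "card V + card W" arbitrary: V W rule: less_induct)
  case less
  show ?case
  proof (cases "minimal_underivable V W")
    case True
    then show ?thesis by blast
  next
    case False
    then obtain V' W' where s: "V' \<subseteq> V" "W' \<subseteq> W" "V' \<noteq> V \<or> W' \<noteq> W" "\<not> der_indep V' W'"
      using less.prems by (auto simp: minimal_underivable_def)
    have fin: "finite V" "finite W" using less.prems finite_D by (meson finite_subset)+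
    have "card V' + card W' < card V + card W"
      using s fin by (metis add_le_less_mono add_less_le_mono card_mono psubsetI psubset_card_mono)
    moreover have "V' \<subseteq> D" "W' \<subseteq> D" "V' \<inter> W' = {}" using s less.prems by auto
    ultimately have "\<exists>V''\<subseteq>V'. \<exists>W''\<subseteq>W'. minimal_underivable V'' W''"
      using s(4) by (rule less.hyps)
    then show ?thesis using s by (meson order_trans)
  qed
qed

lemma minimal_underivableD:
  assumes "minimal_underivable V W" "V' \<subseteq> V" "W' \<subseteq> W" "V' \<noteq> V \<or> W' \<noteq> W"
  shows "der_indep V' W'"
  using assms unfolding minimal_underivable_def by blast

lemma minimal_underivable_sym: "minimal_underivable V W \<Longrightarrow> minimal_underivable W V"
  unfolding minimal_underivable_def by (metis der_indep_sym inf_commute)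

lemma minimal_underivable_nonempty: "minimal_underivable V W \<Longrightarrow> V \<noteq> {}"
  unfolding minimal_underivable_def using der_indep_empty by blast

text \<open>Without \<open>z\<close> the atom is derivable by minimality, and a constant
  \<open>z\<close> could be put back.\<close>

lemma minimal_underivable_not_const_right:
  assumes "minimal_underivable V W" "z \<in> W"
  shows "\<not> const z"
proof
  assume "const z"
  have "der_indep V (W - {z})" by (rule minimal_underivableD[OF assms(1)]) (use assms(2) in auto)
  then have "der_indep V (insert z (W - {z}))"
    using \<open>const z\<close> assms by (intro der_indep_insert_const) (auto simp: minimal_underivable_def)
  then show False using assms by (simp add: minimal_underivable_def insert_absorb)
qed

lemma minimal_underivable_not_const:
  "minimal_underivable V W \<Longrightarrow> z \<in> V \<union> W \<Longrightarrow> \<not> const z"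
  using minimal_underivable_not_const_right minimal_underivable_sym by blast

text \<open>A derivable atom that divides \<open>V \<union> W\<close> properly could be combined, by
  decomposition and contraction, with the smaller derivable atoms into a derivation of the minimal
  one. Hence the parity team on \<open>V \<union> W\<close> respects every derivable independence
  atom.\<close>

lemma minimal_underivable_split:
  assumes min: "minimal_underivable V W" and PQ: "der_indep P Q" and sub: "V \<union> W \<subseteq> P \<union> Q"
  shows "V \<union> W \<subseteq> P \<or> V \<union> W \<subseteq> Q"
proof (rule ccontr)
  assume n: "\<not> ?thesis"
  note less = minimal_underivableD[OF min]
  have V: "V = (P \<inter> V) \<union> (Q \<inter> V)" and W: "W = (P \<inter> W) \<union> (Q \<inter> W)" using sub by auto
  have split: "der_indep (P \<inter> V \<union> P \<inter> W) (Q \<inter> V \<union> Q \<inter> W)"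
    using PQ by (rule der_indep_subset) auto
  have "der_indep V W"
  proof (cases "P \<inter> V = {}")
    case True
    then have QV: "Q \<inter> V = V" using V by auto
    \<comment> \<open>Here \<open>V\<close> lies in \<open>Q\<close>, so \<open>W\<close> does not,
      and \<open>Q \<inter> W\<close> is a proper part of \<open>W\<close>.\<close>
    have "der_indep V (Q \<inter> W)" using less[of V "Q \<inter> W"] n QV by auto
    moreover have "der_indep (V \<union> Q \<inter> W) (P \<inter> W)"
      using der_indep_sym[OF split] True QV by simp
    ultimately have "der_indep V (Q \<inter> W \<union> P \<inter> W)" by (rule der_indep_contraction)
    then show ?thesis using W by (simp add: Un_commute)
  next
    case False
    \<comment> \<open>\<open>P\<close> does not contain \<open>V \<union> W\<close>, so this pair is
      strictly below the minimal one.\<close>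
    have "der_indep (P \<inter> V) (P \<inter> W)" using less[of "P \<inter> V" "P \<inter> W"] n by auto
    then have "der_indep (P \<inter> V) (P \<inter> W \<union> (Q \<inter> V \<union> Q \<inter> W))"
      using split by (rule der_indep_contraction)
    then have 1: "der_indep (W \<union> Q \<inter> V) (P \<inter> V)"
      using der_indep_sym W by (metis sup_assoc sup_commute)
    \<comment> \<open>\<open>V\<close> meets \<open>P\<close>, which is disjoint from
      \<open>Q\<close>. Minimality therefore applies to \<open>W\<close> and
      \<open>Q \<inter> V\<close>, and a second contraction restores all of
      \<open>V\<close>.\<close>
    have "Q \<inter> V \<noteq> V" using False der_indepD(3)[OF PQ] by blast
    then have "der_indep W (Q \<inter> V)" using less[of "Q \<inter> V" W] der_indep_sym by auto
    from der_indep_contraction[OF this 1] have "der_indep W (Q \<inter> V \<union> P \<inter> V)" .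
    then show ?thesis using V der_indep_sym by (metis sup_commute)
  qed
  then show False using min by (simp add: minimal_underivable_def)
qed

text \<open>The conditions concern all derivable atoms, since the countermodels are built from
  derivability; the members of \<open>\<Sigma>\<close> are among them.\<close>

lemma sat_hyps:
  fixes w :: "('v \<Rightarrow> 'a) \<Rightarrow> 'k::comm_semiring_1"
  assumes "uniform_team D F X w"
    and "\<And>x. x \<in> D \<Longrightarrow> const x \<Longrightarrow> card (F x) = 1"
    and "\<And>x y. der (x \<approx> y) \<Longrightarrow> F x = F y"
    and "\<And>x y. der (x \<approx>* y) \<Longrightarrow> card (F x) = card (F y)"
    and "\<And>V W. der_indep V W \<Longrightarrow> count_indep X V W"
    and "\<sigma> \<in> \<Sigma>"
  shows "sat (uniform_team.A D F) X w \<sigma>"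
proof -
  interpret uniform_team D F X w by fact
  have d: "der \<sigma>" and o: "atom_over D \<sigma>" "unary_constancy \<sigma>"
    using \<open>\<sigma> \<in> \<Sigma>\<close> \<Sigma> by (auto simp: derives_hyp IA_UCA_UMI_UMDE_atoms_def)
  show ?thesis
  proof (cases \<sigma>)
    case (Constancy ys)
    then obtain x where "ys = [x]" using o(2) by (auto simp: length_Suc_conv)
    then show ?thesis
      using Constancy d o assms(2) sat_Constancy_uniform_iff by (simp del: sat.simps)
  next
    case (Indep ys zs)
    then show ?thesis
      using d o assms(5) der_imp_der_indep sat_Indep_iff[OF team, where w = w] indep_iff by (simp del: sat.simps)
  next
    case (UMI x y)
    then show ?thesis using d o assms(3) sat_UMI_uniform_iff by (simp del: sat.simps)
  next
    case (UMDE x y)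
    then show ?thesis using d o assms(4) sat_UMDE_uniform_iff by (simp del: sat.simps)
  qed
qed

end

section \<open>Countermodels for the four kinds of atoms\<close>

lemma completeness:
  fixes D :: "'v set"
  assumes inf: "infinite (UNIV :: 'a set)"
    and of_nat_eq: "\<And>m n. (of_nat m :: 'k::comm_semiring_1) = of_nat n \<longleftrightarrow> m = n"
    and "finite D" and atoms: "\<Sigma> \<union> {\<tau>} \<subseteq> IA_UCA_UMI_UMDE_atoms D"
    and entails: "entails TYPE('k) TYPE('a) D \<Sigma> \<tau>"
  shows "derives (axiom_instances D) \<Sigma> \<tau>"
proof (rule ccontr)
  interpret deduction D \<Sigma> using assms by unfold_locales auto
  assume not_der: "\<not> der \<tau>"
  have \<tau>: "atom_over D \<tau>" "unary_constancy \<tau>"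
    using atoms by (auto simp: IA_UCA_UMI_UMDE_atoms_def)
  \<comment> \<open>\<open>b\<close> supplies distinct values, so that value sets can be described
    by sets of natural numbers.\<close>
  obtain b :: "nat \<Rightarrow> 'a" where b: "inj b" using inf infinite_countable_subset by blast
  have card_b: "card (b ` N) = card N" for N using b by (meson card_image inj_on_subset subset_UNIV)
  define w where "w = (\<lambda>_ :: 'v \<Rightarrow> 'a. 1 :: 'k)"
  have countermodel: False
    if "uniform D F X" "\<And>x. const x \<Longrightarrow> card (F x) = 1" "\<And>x y. der (x \<approx> y) \<Longrightarrow> F x = F y"
      "\<And>x y. der (x \<approx>* y) \<Longrightarrow> card (F x) = card (F y)"
      "\<And>V W. der_indep V W \<Longrightarrow> count_indep X V W"
      "uniform_team D F X w \<Longrightarrow> \<not> sat (uniform_team.A D F) X w \<tau>" for F X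
  proof -
    interpret uniform_team D F X w
      using that(1) of_nat_eq finite_D w_def by unfold_locales
    have "\<forall>\<sigma>\<in>\<Sigma>. sat A X w \<sigma>"
      using sat_hyps[OF uniform_team_axioms] that(2-5) by blast
    then have "sat A X w \<tau>"
      using entails team unfolding entails_def by blast
    then show False using that(6) uniform_team_axioms by blast
  qed
  \<comment> \<open>In a product team every disjoint independence atom holds, so only the value sets
    \<open>N x\<close> remain to be chosen.\<close>
  have countermodel_PiE: False
    if N: "\<And>x. x \<in> D \<Longrightarrow> finite (N x) \<and> N x \<noteq> {}"
      "\<And>x. const x \<Longrightarrow> card (N x) = 1" "\<And>x y. der (x \<approx> y) \<Longrightarrow> N x = N y"
      "\<And>x y. der (x \<approx>* y) \<Longrightarrow> card (N x) = card (N y)"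
      "\<And>X. uniform_team D (\<lambda>v. b ` N v) X w \<Longrightarrow>
        \<not> sat (uniform_team.A D (\<lambda>v. b ` N v)) X w \<tau>" for N :: "'v \<Rightarrow> nat set"
  proof (rule countermodel[of "\<lambda>v. b ` N v" "\<Pi>\<^sub>E v\<in>D. b ` N v"])
    show "uniform D (\<lambda>v. b ` N v) (\<Pi>\<^sub>E v\<in>D. b ` N v)"
      using finite_D N(1) by (intro uniform_PiE) auto
    show "count_indep (\<Pi>\<^sub>E v\<in>D. b ` N v) V W" if "der_indep V W" for V W
      using count_indep_PiE finite_D der_indepD[OF that] by blast
  qed (use N card_b in auto)
  show False
  proof (cases \<tau>)
    case (Constancy ys)
    then obtain x where x: "\<tau> = Constancy [x]" "x \<in> D" using \<tau> by (auto simp: length_Suc_conv)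
    show False
    proof (rule countermodel_PiE[of "\<lambda>v. if const v then {0} else {0, 1}"])
      fix X assume "uniform_team D (\<lambda>v. b ` (if const v then {0} else {0, 1})) X w"
      then interpret uniform_team D "\<lambda>v. b ` (if const v then {0} else {0, 1})" X w .
      show "\<not> sat A X w \<tau>"
        unfolding x(1) sat_Constancy_uniform_iff[OF x(2)] using not_der x(1) by (simp only: card_b) simp
    qed (use UMDE_const_iff der_UMI_imp_UMDE in auto)
  next
    case (UMI x y)
    then have xy: "x \<in> D" "y \<in> D" using \<tau> by auto
    \<comment> \<open>The values 0, 1 serve the \<open>\<approx>\<close> class of \<open>x\<close>
      and 2, 3 all other variables. The number of values depends on constancy alone, as the
      derivable \<open>\<approx>*\<close> atoms require.\<close>
    define N :: "'v \<Rightarrow> nat set" where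
      "N v = (if der (x \<approx> v) then if const v then {0} else {0, 1}
              else if const v then {2} else {2, 3})" for v
    have "N u = N v" if "der (u \<approx> v)" for u v
    proof -
      have "der (x \<approx> u) \<longleftrightarrow> der (x \<approx> v)" using that der_UMI_trans der_UMI_sym by blast
      moreover have "const u \<longleftrightarrow> const v" using that der_UMI_imp_UMDE UMDE_const_iff by blast
      ultimately show ?thesis by (simp add: N_def)
    qed
    moreover have "card (N u) = card (N v)" if "der (u \<approx>* v)" for u v
      using UMDE_const_iff[OF that] by (simp add: N_def)
    moreover have "\<not> sat (uniform_team.A D (\<lambda>v. b ` N v)) X w \<tau>"
      if "uniform_team D (\<lambda>v. b ` N v) X w" for X
    proof -
      interpret uniform_team D "\<lambda>v. b ` N v" X w by fact
      have "0 \<in> N x" "0 \<notin> N y"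
        using not_der UMI der_UMI_refl[OF xy(1)] by (auto simp: N_def)
      then have "b ` N x \<noteq> b ` N y" using b by (metis inj_image_eq_iff)
      then show ?thesis unfolding UMI sat_UMI_uniform_iff[OF xy] .
    qed
    ultimately show False by (intro countermodel_PiE[of N]) (auto simp: N_def)
  next
    case (UMDE x y)
    then have xy: "x \<in> D" "y \<in> D" using \<tau> by auto
    \<comment> \<open>One value for constants, two for the nonconstant variables in the
      \<open>\<approx>*\<close> class of \<open>x\<close>, three for the rest.\<close>
    define N :: "'v \<Rightarrow> nat set" where
      "N v = (if const v then {0} else if der (x \<approx>* v) then {0, 1} else {0, 1, 2})" for v
    have N_eq: "N u = N v" if "der (u \<approx>* v)" for u v
    proof -
      have "der (x \<approx>* u) \<longleftrightarrow> der (x \<approx>* v)" using that der_UMDE_trans der_UMDE_sym by blast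
      then show ?thesis using UMDE_const_iff[OF that] by (simp add: N_def)
    qed
    have refuted: "\<not> sat (uniform_team.A D (\<lambda>v. b ` N v)) X w \<tau>"
      if "uniform_team D (\<lambda>v. b ` N v) X w" for X
    proof -
      interpret uniform_team D "\<lambda>v. b ` N v" X w by fact
      \<comment> \<open>Not both variables are constant, as otherwise \<open>x \<approx>* y\<close>
        would be derivable; in the remaining cases the sizes differ.\<close>
      have "card (N x) \<noteq> card (N y)"
        using not_der UMDE der_UMDE_refl[OF xy(1)] const_imp_UMDE[of x y] by (auto simp: N_def)
      then show ?thesis unfolding UMDE sat_UMDE_uniform_iff[OF xy] card_b .
    qed
    show False
    proof (rule countermodel_PiE[of N])
      show "N u = N v" if "der (u \<approx> v)" for u v
        using N_eq der_UMI_imp_UMDE that by blast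
      show "card (N u) = card (N v)" if "der (u \<approx>* v)" for u v
        using N_eq[OF that] by simp
    qed (use refuted in \<open>auto simp: N_def\<close>)
  next
    case (Indep ys zs)
    then have yz: "set ys \<subseteq> D" "set zs \<subseteq> D" "set ys \<inter> set zs = {}" using \<tau> by auto
    have "\<not> der_indep (set ys) (set zs)" using not_der Indep der_indep_set by blast
    then obtain V W where sub: "V \<subseteq> set ys" "W \<subseteq> set zs" and min: "minimal_underivable V W"
      using minimal_underivable_exists[OF yz] by blast
    have ne: "V \<noteq> {}" "W \<noteq> {}"
      using min minimal_underivable_nonempty minimal_underivable_sym by blast+
    \<comment> \<open>All nonconstant variables share one set of two bits. Derivable marginal atoms
      relate only variables of equal constancy, hence of equal range.\<close>
    define F where "F v = (if const v then {b 0} else {b 0, b 1})" for v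
    have b01: "b 1 \<noteq> b 0" using b by (metis injD zero_neq_one)
    interpret parity D F "V \<union> W" "b 1" "b 0"
    proof
      show "F u = {b 0, b 1}" if "u \<in> V \<union> W" for u
        using minimal_underivable_not_const[OF min that] by (simp add: F_def)
    qed (use finite_D b01 yz sub in \<open>auto simp: F_def\<close>)
    have disj: "V \<inter> W = {}" using sub yz by blast
    show False
    proof (rule countermodel[of F X])
      show "uniform D F X"
      proof (rule uniform_even_team)
        fix x
        obtain v v' where "v \<in> V" "v' \<in> W" using ne by blast
        \<comment> \<open>Nonempty disjoint \<open>V\<close> and \<open>W\<close> give the parity
          constraint two different variables, as uniformity requires.\<close>
        moreover from this have "v \<noteq> v'" using disj by blast
        ultimately show "\<exists>u\<in>V \<union> W. u \<noteq> x" by (metis UnI1 UnI2)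
      qed
      show "count_indep X P Q" if "der_indep P Q" for P Q
      proof (rule count_indep_even_team)
        show "V \<union> W \<subseteq> P \<or> V \<union> W \<subseteq> Q" if "V \<union> W \<subseteq> P \<union> Q"
          using min \<open>der_indep P Q\<close> that by (rule minimal_underivable_split)
      qed (use der_indepD[OF that] ne in simp_all)
      assume "uniform_team D F X w"
      then interpret uniform_team D F X w .
      show "\<not> sat A X w \<tau>"
      proof
        assume "sat A X w \<tau>"
        then have "indep X w (set ys) (set zs)"
          using Indep sat_Indep_iff[OF team yz(1,2), where w = w] by blast
        \<comment> \<open>Decomposition is valid in the team, so satisfying \<open>\<tau>\<close>
          would make the minimal atom hold, which the parity constraint prevents.\<close>
        then have "indep X w V W"
          using weighted_team.indep_mono[OF weighted_team.intro[OF team]] yz sub by blast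
        then have "count_indep X V W" by (simp only: indep_iff)
        then show False
          using not_count_indep_even_team[of V W] disj ne by blast
      qed
    qed (auto simp: F_def UMDE_const_iff dest: der_UMI_imp_UMDE)
  qed
qed

theorem theorem4:
  fixes D :: "'v set" and \<Sigma> :: "'v atom set" and \<tau> :: "'v atom"
  assumes positive_add: "\<forall>(a::'k::comm_semiring_1) b. a + b = 0 \<longrightarrow> a = 0 \<and> b = 0"
    and positive_mult: "\<forall>(a::'k) b. a * b = 0 \<longrightarrow> a = 0 \<or> b = 0"
    and cancel_add: "\<forall>(a::'k) b c. a + b = a + c \<longrightarrow> b = c"
    and cancel_mult:
      "\<forall>(a::'k) b c. a \<noteq> 0 \<longrightarrow> (a * b = a * c \<longrightarrow> b = c) \<and> (b * a = c * a \<longrightarrow> b = c)"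
    and infinite_values: "infinite (UNIV :: 'a set)"
    and "finite D"
    and "finite \<Sigma>"
    and "\<Sigma> \<union> {\<tau>} \<subseteq> IA_UCA_UMI_UMDE_atoms D"
  shows "derives (axiom_instances D) \<Sigma> \<tau> \<longleftrightarrow> entails TYPE('k) TYPE('a) D \<Sigma> \<tau>"
proof
  assume "derives (axiom_instances D) \<Sigma> \<tau>"
  then show "entails TYPE('k) TYPE('a) D \<Sigma> \<tau>"
    using positive_add cancel_mult by (intro soundness) blast+
next
  have "(of_nat m :: 'k) = of_nat n \<longleftrightarrow> m = n" for m n
    using positive_add cancel_add by (intro of_nat_eq_iff_cancellative) blast+
  moreover assume "entails TYPE('k) TYPE('a) D \<Sigma> \<tau>"
  ultimately show "derives (axiom_instances D) \<Sigma> \<tau>"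
    using completeness infinite_values assms(6,8) by blast
qed

end
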